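(* Let $x,x_1,x_2$ be roots of unity with $x\neq1$, let $a\in\mathbb{C}\setminus\mathbb{Z}$, and let $p_1,p_2,q\in\mathbb{N}$ with $(p_1,x_1)\ne(1,1)$, $(p_2,x_2)\ne(1,1)$ and $(q,xx_1x_2)\ne(1,1)$. Writing $D_k:=(-1)^k\mathrm{Li}_{k+1}(x)-\mathrm{Li}_{k+1}(x^{-1})$ and $y:=xx_1x_2$, we have \begin{align*} &(-1)^{p_1+p_2+q+1}R_{p_1,p_2;q}^{(-a)}\big(x_1^{-1},x_2^{-1};y\big)-y^{-1}R^{(a+1)}_{p_1,p_2;q}\big(x_1,x_2;y^{-1}\big)\\ &=\mathrm{Li}_{p_1}(x_1)\mathrm{Li}_{p_2}(x_2)\mathrm{Li}_q\big(y^{-1};a+1\big)-y^{-1}\mathrm{Li}_{p_1}(x_1)R^{(a+1)}_{p_2;q}\big(x_2;y^{-1}\big)-y^{-1}\mathrm{Li}_{p_2}(x_2)R^{(a+1)}_{p_1;q}\big(x_1;y^{-1}\big)\\ &\quad+(-1)^q y^{-1}\binom{q+p_1+p_2-1}{q-1}\mathrm{Li}_{q+p_1+p_2}(y;-a)\\ &\quad+(-1)^q\sum_{k=0}^{p_1}\binom{k+p_2-1}{p_2-1}\binom{q+p_1-k-1}{q-1}\left((-1)^k y^{-1}\mathrm{Li}_{k+p_2}(x_2)\mathrm{Li}_{p_1+q-k}(y;-a)+(-1)^{p_2}R_{k+p_2;p_1+q-k}^{(-a)}\big(x_2^{-1};y\big)\right)\\ &\quad+(-1)^q\sum_{k=0}^{p_2}\binom{k+p_1-1}{p_1-1}\binom{q+p_2-k-1}{q-1}\left((-1)^k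 y^{-1}\mathrm{Li}_{k+p_1}(x_1)\mathrm{Li}_{p_2+q-k}(y;-a)+(-1)^{p_1}R_{k+p_1;p_2+q-k}^{(-a)}\big(x_1^{-1};y\big)\right)\\ &\quad+(-1)^q y^{-1}\sum_{k=0}^{p_1+p_2-1}\binom{q+p_1+p_2-k-2}{q-1}D_k\,\mathrm{Li}_{q+p_1+p_2-k-1}(y;-a)\\ &\quad+(-1)^q y^{-1}\mathrm{Li}_{p_1}(x_1)\mathrm{Li}_{p_2}(x_2)\mathrm{Li}_q(y;-a)+(-1)^{q+p_2}\mathrm{Li}_{p_1}(x_1)R_{p_2;q}^{(-a)}\big(x_2^{-1};y\big)+(-1)^{q+p_1}\mathrm{Li}_{p_2}(x_2)R_{p_1;q}^{(-a)}\big(x_1^{-1};y\big)\\ &\quad+(-1)^q\sum_{\substack{k_1+k_2\le p_1-1\\k_1,k_2\ge0}}\binom{k_2+p_2-1}{p_2-1}\binom{q+p_1-k_1-k_2-2}{q-1}D_{k_1}\\ &\qquad\times\left((-1)^{k_2}y^{-1}\mathrm{Li}_{k_2+p_2}(x_2)\mathrm{Li}_{p_1+q-k_1-k_2-1}(y;-a)+(-1)^{p_2}R^{(-a)}_{k_2+p_2;p_1+q-k_1-k_2-1}\big(x_2^{-1};y\big)\right)\\ &\quad+(-1)^q\sum_{\substack{k_1+k_2\le p_2-1\\k_1,k_2\ge0}}\binom{k_2+p_1-1}{p_1-1}\binom{q+p_2-k_1-k_2-2}{q-1}D_{k_1}\\ &\qquad\times\left((-1)^{k_2}y^{-1}\mathrm{Li}_{k_2+p_1}(x_1)\mathrm{Li}_{p_2+q-k_1-k_2-1}(y;-a)+(-1)^{p_1}R^{(-a)}_{k_2+p_1;p_2+q-k_1-k_2-1}\big(x_1^{-1};y\big)\right)\\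 &\quad+\sum_{\substack{k_1+k_2+k_3=q-1\\k_1,k_2,k_3\ge0}}\left((-1)^{k_1}\mathrm{Li}_{k_1+1}(x;1-a)-x\,\mathrm{Li}_{k_1+1}\big(x^{-1};a\big)\right)\\ &\qquad\times(-1)^{k_2+k_3}\binom{k_2+p_1-1}{p_1-1}\binom{k_3+p_2-1}{p_2-1}\mathrm{Li}_{k_2+p_1}(x_1;-a)\mathrm{Li}_{k_3+p_2}(x_2;-a)(x_1x_2)^{-1}. \end{align*}
   Context: For $|w|\le1$, $m\in\mathbb{N}$ with $(m,w)\ne(1,1)$, $b\in\mathbb{C}\setminus\{0,-1,-2,\dots\}$: $\mathrm{Li}_m(w;b)=\sum_{n\ge1}\frac{w^n}{(n+b-1)^m}$, $\mathrm{Li}_m(w)=\sum_{n\ge1}\frac{w^n}{n^m}$. For $n\ge0$: $\zeta_n(p;w)=\sum_{k=1}^n\frac{w^k}{k^p}$. For roots of unity $u_1,\dots,u_r,v$, positive integers $p_1,\dots,p_r,q$ with $(q,v)\ne(1,1)$ and $b\in\mathbb{C}\setminus\mathbb{Z}$, the Hurwitz-type cyclotomic Euler $R$-sum is $R^{(b)}_{p_1,\dots,p_r;q}(u_1,\dots,u_r;v)=\sum_{n\ge1}\frac{\zeta_n(p_1;u_1)\cdots\zeta_n(p_r;u_r)}{(n+b)^q}v^n$. *)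

theory Defs
  imports "HOL-Analysis.Analysis"
begin

definition root_of_unity :: "complex \<Rightarrow> bool" where
  "root_of_unity u \<longleftrightarrow> (\<exists>N::nat. N > 0 \<and> u ^ N = 1)"

(* The series below run over n >= 1, hence the shift to "Suc n".  For exponent 1 they
   converge only conditionally, so they are sums of sequences ("suminf"), not unordered sums.
   The value is meaningful only under the usual side conditions: m >= 1, |w| <= 1,
   (m, w) \<noteq> (1, 1) and b not in {0, -1, -2, ...}. *)

definition Li_Hurwitz :: "nat \<Rightarrow> complex \<Rightarrow> complex \<Rightarrow> complex" where
  "Li_Hurwitz m w b = (\<Sum>n. w ^ Suc n / (of_nat (Suc n) + b - 1) ^ m)"

definition Li :: "nat \<Rightarrow> complex \<Rightarrow> complex" where
  "Li m w = (\<Sum>n. w ^ Suc n / of_nat (Suc n) ^ m)"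

definition zeta_partial :: "nat \<Rightarrow> nat \<Rightarrow> complex \<Rightarrow> complex" where
  "zeta_partial n p w = (\<Sum>k=1..n. w ^ k / of_nat k ^ p)"

(* R^(b)_{p_1,...,p_r;q}(u_1,...,u_r;v) is "Rsum b [(p_1, u_1), ..., (p_r, u_r)] q v". *)
definition Rsum :: "complex \<Rightarrow> (nat \<times> complex) list \<Rightarrow> nat \<Rightarrow> complex \<Rightarrow> complex" where
  "Rsum b pus q v =
     (\<Sum>n. (\<Prod>(p, u)\<leftarrow>pus. zeta_partial (Suc n) p u) / (of_nat (Suc n) + b) ^ q * v ^ Suc n)"

definition D_coeff :: "complex \<Rightarrow> nat \<Rightarrow> complex" where
  "D_coeff x k = (-1) ^ k * Li (k + 1) x - Li (k + 1) (inverse x)"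

end

theory Submission
  imports Defs "HOL-Complex_Analysis.Complex_Analysis" "HOL-Real_Asymp.Real_Asymp"
begin

text \<open>
  Up to signs, both sides collect the residues of
  $\Phi(s;x)\,\varphi_{p_1}(s;x_1)\,\varphi_{p_2}(s;x_2)/(s+a)^q$, where
  $\varphi_p(s;u)=\sum_{k\ge0}u^k/(k+s)^p$ and $\Phi(s;x)=\sum_{k\in Z}x^k/(k+s)$: the pole $-a$
  gives the triple sum, the positive integers give the $R^{(a+1)}$ terms, and the poles of order
  $1+p_1+p_2$ at the integers $-n\le0$ give all the rest.  Instead of integrating over large
  contours, all three series are truncated at $N$.  The residues of the resulting rational function
  add up to $0$, and the truncation changes the residue at $\pm n$ by
  $O(1/((n+1)(N-n+1)))$, which summed over $n\le N$ tends to $0$.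
\<close>

section \<open>Residues and power series\<close>

text \<open>Why this product of functions: at \<open>s = -n + t\<close> the series phi_p(s;u) equals
  \<open>u^n\<close> times \<open>1/t^p\<close> plus a regular series, whose coefficients mix full
  polylogarithms (from the terms k > n) with n-th partial zeta sums (from the terms k < n).
  Multiplying such factors makes products of partial zeta sums appear as Taylor coefficients, while
  the twists combine to \<open>y^n\<close>. The two-sided kernel Phi behaves likewise, but its
  regular coefficients D_k do not depend on n, and it alone is singular at the positive integers,
  where the phi_p are tails of polylogarithms. The obstacle is exponent 1: for q = 1 the residues at
  -n are in general only O(1/n), so there is no summable majorant and limit and sum cannot be
  exchanged by domination. A rate replaces it. Summation by parts gives every series involved, even
  the conditionally convergent ones, tails of order 1/M; set against the weight 1/(n+1), the cut at
  N then costs O(log N / N) in total.\<close>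

lemma sum_residues_eq_0:
  fixes f :: "complex \<Rightarrow> complex"
  assumes "finite P" and holo: "f holomorphic_on (UNIV - P)"
    and lim: "((\<lambda>z. z * f z) \<longlongrightarrow> 0) at_infinity"
  shows "(\<Sum>p\<in>P. residue f p) = 0"
proof -
  let ?S = "\<Sum>p\<in>P. residue f p"
  have "norm ?S \<le> e" if "e > 0" for e
  proof -
    obtain b where b: "\<And>z. norm z \<ge> b \<Longrightarrow> norm (z * f z) < e"
      using lim \<open>e > 0\<close> unfolding tendsto_iff eventually_at_infinity dist_norm by auto
    obtain c where c: "\<And>p. p \<in> P \<Longrightarrow> norm p \<le> c"
      using finite_imp_bounded[OF \<open>finite P\<close>] by (auto simp: bounded_iff)
    define R where "R = max (max b c) 0 + 1"
    have R: "R > 0" "R \<ge> b" "R > c" by (auto simp: R_def)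
    have P: "p \<notin> P" if "norm p = R" for p
      using c[of p] that R by auto
    have wind: "winding_number (circlepath 0 R) p = 1" if "p \<in> P" for p
      using c[OF that] R by (intro winding_number_circlepath) auto
    have "contour_integral (circlepath 0 R) f =
        2 * pi * \<i> * (\<Sum>p\<in>P. winding_number (circlepath 0 R) p * residue f p)"
      using assms P R by (intro Residue_theorem[of UNIV]) auto
    also have "(\<Sum>p\<in>P. winding_number (circlepath 0 R) p * residue f p) = ?S"
      by (intro sum.cong) (auto simp: wind)
    finally have eq: "contour_integral (circlepath 0 R) f = 2 * pi * \<i> * ?S" .
    have "f contour_integrable_on circlepath 0 R"
      using P R \<open>finite P\<close>
      by (intro contour_integrable_holomorphic_simple[OF holo]) (auto intro!: open_Diff finite_imp_closed)
    then have "(f has_contour_integral 2 * pi * \<i> * ?S) (circlepath 0 R)"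
      unfolding eq[symmetric] by (rule has_contour_integral_integral)
    \<comment> \<open>The length 2 pi R of the circle cancels the 1/R, which leaves 2 pi e.\<close>
    moreover have "norm (f z) \<le> e / R" if "norm (z - 0) = R" for z
      using b[of z] R that by (simp add: norm_mult field_simps)
    ultimately have "norm (2 * pi * \<i> * ?S) \<le> e / R * (2 * pi * R)"
      using R \<open>e > 0\<close> by (intro has_contour_integral_bound_circlepath) auto
    then show ?thesis
      using R by (simp add: norm_mult)
  qed
  then have "norm ?S \<le> 0"
    by (rule field_le_epsilon[of _ 0, simplified])
  then show ?thesis by simp
qed

text \<open>Turns residues into coefficient extraction: a pole of high order needs no derivatives
  once the regular factor is known as a product of formal power series.\<close>

lemma residue_eq_fps_nth:
  assumes "g has_fps_expansion G"
    and ev: "eventually (\<lambda>t. f (z + t) = g t / t ^ Suc n) (at 0)"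
  shows "residue f z = fps_nth G n"
proof -
  have "residue f z = residue (\<lambda>t. f (z + t)) 0"
    by (rule residue_shift_0)
  also have "\<dots> = residue (\<lambda>t. g t / t ^ Suc n) 0"
    by (intro residue_cong ev refl)
  also have "\<dots> = fps_nth G n"
    by (rule residue_fps_expansion_over_power_at_0) fact
  finally show ?thesis .
qed

text \<open>The negative binomial series of \<open>1 / (c + t) ^ m\<close> for m >= 1; at m = 0 the
  truncated subtractions would turn every binomial coefficient into 1. These coefficients are the
  source of the binomials in the identity.\<close>

definition fps_recip_power :: "complex \<Rightarrow> nat \<Rightarrow> complex fps" where
  "fps_recip_power c m =
     Abs_fps (\<lambda>k. (-1) ^ k * of_nat ((k + m - 1) choose (m - 1)) / c ^ (k + m))"

text \<open>Coefficientwise this is Pascal's rule.\<close>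

lemma fps_recip_power_Suc:
  assumes "c \<noteq> 0" "m \<ge> 1"
  shows "(fps_const c + fps_X) * fps_recip_power c (Suc m) = fps_recip_power c m"
proof (rule fps_ext)
  fix k
  show "fps_nth ((fps_const c + fps_X) * fps_recip_power c (Suc m)) k = fps_nth (fps_recip_power c m) k"
  proof (cases k)
    case 0
    then show ?thesis using assms by (simp add: fps_recip_power_def field_simps)
  next
    case (Suc j)
    obtain l where l: "m = Suc l" using assms by (cases m) auto
    show ?thesis using assms
      by (simp add: Suc l fps_recip_power_def field_simps distrib_right distrib_left)
  qed
qed

lemma has_fps_expansion_recip_power:
  assumes "c \<noteq> 0" "m \<ge> 1"
  shows "(\<lambda>t. 1 / (c + t) ^ m) has_fps_expansion fps_recip_power c m"
proof -
  have *: "(fps_const c + fps_X) ^ m * fps_recip_power c m = 1"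
    using assms(2)
  proof (induction m rule: dec_induct)
    case base
    show ?case
    proof (rule fps_ext)
      fix k
      show "fps_nth ((fps_const c + fps_X) ^ 1 * fps_recip_power c 1) k = fps_nth 1 k"
        using assms(1) by (cases k) (auto simp: fps_recip_power_def field_simps distrib_right)
    qed
  next
    case (step m)
    have "(fps_const c + fps_X) ^ Suc m * fps_recip_power c (Suc m) =
        (fps_const c + fps_X) ^ m * ((fps_const c + fps_X) * fps_recip_power c (Suc m))"
      by (simp only: power_Suc mult_ac)
    also have "\<dots> = 1"
      using step assms(1) by (simp add: fps_recip_power_Suc)
    finally show ?case .
  qed
  have nz: "fps_nth ((fps_const c + fps_X) ^ m) 0 \<noteq> 0"
    using assms by (simp add: fps_nth_power_0)
  have "(\<lambda>t. inverse ((c + t) ^ m)) has_fps_expansion inverse ((fps_const c + fps_X) ^ m)"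
    by (intro fps_expansion_intros nz)
  also have "inverse ((fps_const c + fps_X) ^ m) = fps_recip_power c m"
    using * nz by (metis fps_inverse_unique)
  finally show ?thesis by (simp add: field_simps)
qed

section \<open>Conditionally convergent series\<close>

text \<open>Partial fractions: the two factors add up to N + 2, so the sum is twice the harmonic
  number of N + 1 over N + 2.\<close>

lemma sum_recip_convolution_tendsto_0:
  "(\<lambda>N. \<Sum>n\<le>N. 1 / (real (Suc n) * real (Suc (N - n)))) \<longlonglongrightarrow> 0"
proof -
  have eq: "(\<Sum>n\<le>N. 1 / (real (Suc n) * real (Suc (N - n)))) = 2 * harm (Suc N) / real (N + 2)" for N
  proof -
    have "(\<Sum>n\<le>N. 1 / (real (Suc n) * real (Suc (N - n)))) =
      (\<Sum>n\<le>N. (inverse (real (Suc n)) + inverse (real (Suc (N - n)))) / real (N + 2))"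
    proof (intro sum.cong refl)
      fix n assume "n \<in> {..N}"
      then have "real (N + 2) = real (Suc n) + real (Suc (N - n))" by (simp add: of_nat_diff)
      then show "1 / (real (Suc n) * real (Suc (N - n))) =
        (inverse (real (Suc n)) + inverse (real (Suc (N - n)))) / real (N + 2)"
        by (simp add: divide_simps del: of_nat_Suc)
    qed
    also have "\<dots> = ((\<Sum>n\<le>N. inverse (real (Suc n))) + (\<Sum>n\<le>N. inverse (real (Suc (N - n))))) / real (N + 2)"
      by (simp only: sum_divide_distrib[symmetric] sum.distrib)
    also have "(\<Sum>n\<le>N. inverse (real (Suc (N - n)))) = (\<Sum>n\<le>N. inverse (real (Suc n)))"
      by (rule sum.reindex_bij_witness[of _ "\<lambda>n. N - n" "\<lambda>n. N - n"]) auto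
    also have "(\<Sum>n\<le>N. inverse (real (Suc n))) = harm (Suc N)"
      by (simp only: harm_altdef lessThan_Suc_atMost)
    finally show ?thesis by simp
  qed
  obtain c where "(\<lambda>n. harm n - ln (real n)) \<longlonglongrightarrow> c"
    using euler_mascheroni_convergent by (auto simp: convergent_def)
  then have "(\<lambda>n. harm (Suc n) - ln (real (Suc n))) \<longlonglongrightarrow> c"
    by (rule LIMSEQ_Suc)
  moreover have "(\<lambda>N. 2 / real (N + 2)) \<longlonglongrightarrow> 0" by real_asymp
  ultimately have "(\<lambda>N. (2 / real (N + 2)) * (harm (Suc N) - ln (real (Suc N)))) \<longlonglongrightarrow> 0 * c"
    by (intro tendsto_mult)
  moreover have "(\<lambda>N. (2 / real (N + 2)) * ln (real (Suc N))) \<longlonglongrightarrow> 0" by real_asymp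
  ultimately have "(\<lambda>N. (2 / real (N + 2)) * (harm (Suc N) - ln (real (Suc N))) + (2 / real (N + 2)) * ln (real (Suc N))) \<longlonglongrightarrow> 0 * c + 0"
    by (rule tendsto_add)
  then show ?thesis unfolding eq
    by (simp add: right_diff_distrib diff_divide_distrib del: of_nat_Suc)
qed

text \<open>Slow variation of the coefficients is what summation by parts needs; the partial zeta sums have
  it even when they converge only conditionally.\<close>

definition slow :: "(nat \<Rightarrow> complex) \<Rightarrow> bool" where
  "slow c \<longleftrightarrow> (\<exists>C. \<forall>n. norm (c n) \<le> C \<and> norm (c (Suc n) - c n) \<le> C / real (Suc n))"

lemma slow_const [simp, intro]: "slow (\<lambda>_. c)"
  unfolding slow_def by (rule exI[of _ "norm c"]) auto

lemma slow_mult: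
  assumes "slow c" "slow d"
  shows "slow (\<lambda>n. c n * d n)"
proof -
  obtain C where C: "\<And>n. norm (c n) \<le> C" "\<And>n. norm (c (Suc n) - c n) \<le> C / real (Suc n)"
    using assms(1) by (auto simp: slow_def)
  obtain D where D: "\<And>n. norm (d n) \<le> D" "\<And>n. norm (d (Suc n) - d n) \<le> D / real (Suc n)"
    using assms(2) by (auto simp: slow_def)
  have nn: "0 \<le> C" "0 \<le> D" using C(1)[of 0] D(1)[of 0] norm_ge_zero order_trans by blast+
  have "norm (c n * d n) \<le> 2 * C * D" for n
  proof -
    have "norm (c n * d n) \<le> C * D"
      unfolding norm_mult by (intro mult_mono C D nn norm_ge_zero)
    also have "\<dots> \<le> 2 * C * D" using mult_nonneg_nonneg[OF nn] by simp
    finally show ?thesis .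
  qed
  moreover have "norm (c (Suc n) * d (Suc n) - c n * d n) \<le> 2 * C * D / real (Suc n)" for n
  proof -
    have "c (Suc n) * d (Suc n) - c n * d n = (c (Suc n) - c n) * d (Suc n) + c n * (d (Suc n) - d n)"
      by (simp add: algebra_simps)
    also have "norm \<dots> \<le> C / real (Suc n) * D + C * (D / real (Suc n))"
      by (rule norm_triangle_mono; unfold norm_mult; intro mult_mono C D norm_ge_zero nn divide_nonneg_nonneg of_nat_0_le_iff)
    also have "\<dots> = 2 * C * D / real (Suc n)" by simp
    finally show ?thesis .
  qed
  ultimately show ?thesis unfolding slow_def by blast
qed

text \<open>The quotient \<open>(n + 1) / (n + b) = 1 + (1 - b) / (n + b)\<close> converges, hence
  is bounded. \<open>C \<ge> 1\<close> is recorded because it passes to powers of \<open>C\<close>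
  and settles the sign conditions.\<close>

lemma recip_shift_bound:
  fixes b :: complex
  assumes "\<And>n. of_nat n + b \<noteq> 0"
  obtains C where "C \<ge> 1" "\<And>n. norm (1 / (of_nat n + b)) \<le> C / real (Suc n)"
proof -
  have "filterlim (\<lambda>n. of_nat n + b) at_infinity sequentially"
    by (rule tendsto_add_filterlim_at_infinity'[OF tendsto_of_nat tendsto_const])
  then have "(\<lambda>n. inverse (of_nat n + b)) \<longlonglongrightarrow> 0"
    by (rule filterlim_compose[OF tendsto_inverse_0])
  then have "(\<lambda>n. (1 + (1 - b) * inverse (of_nat n + b)) :: complex) \<longlonglongrightarrow> 1 + (1 - b) * 0"
    by (intro tendsto_intros)
  then have "Bseq (\<lambda>n. (1 + (1 - b) * inverse (of_nat n + b)) :: complex)"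
    by (rule convergent_imp_Bseq[OF convergentI])
  then obtain K where K: "K > 0" "\<And>n. norm (1 + (1 - b) * inverse (of_nat n + b)) \<le> K"
    by (auto simp: Bseq_def)
  have "norm (1 / (of_nat n + b)) \<le> (max K 1) / real (Suc n)" for n
  proof -
    have "1 + (1 - b) * inverse (of_nat n + b) = of_nat (Suc n) * (1 / (of_nat n + b))"
      using assms[of n] by (simp add: field_simps)
    then have "real (Suc n) * norm (1 / (of_nat n + b)) \<le> max K 1"
      using K(2)[of n] by (simp add: norm_mult norm_divide del: of_nat_Suc)
    then show ?thesis by (simp add: field_simps del: of_nat_Suc)
  qed
  then show ?thesis by (intro that[of "max K 1"]) auto
qed

lemma recip_shift_power_bound:
  fixes b :: complex
  assumes "\<And>n. of_nat n + b \<noteq> 0"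
  obtains C where "C \<ge> 1" "\<And>n. norm (1 / (of_nat n + b) ^ m) \<le> C / real (Suc n) ^ m"
proof -
  obtain C where C: "C \<ge> 1" "\<And>n. norm (1 / (of_nat n + b)) \<le> C / real (Suc n)"
    using recip_shift_bound assms by metis
  have "norm (1 / (of_nat n + b) ^ m) \<le> C ^ m / real (Suc n) ^ m" for n
    using power_mono[OF C(2)[of n], of m] by (simp add: norm_divide norm_power power_divide)
  then show ?thesis using that[of "C ^ m"] C(1) by (simp add: one_le_power)
qed

text \<open>A Cauchy condition with a rate, on finite blocks, so that it can be proved before any
  sum is known to exist. It yields both convergence and the speed 1/M on which the truncation
  estimates rest.\<close>

definition small_tails :: "(nat \<Rightarrow> complex) \<Rightarrow> bool" where
  "small_tails f \<longleftrightarrow> (\<exists>C. \<forall>M K. norm (sum f {M..<K}) \<le> C / real (Suc M))"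

lemma small_tails_imp_summable:
  assumes "small_tails f"
  shows "summable f"
  unfolding summable_Cauchy
proof (intro allI impI)
  fix e :: real assume "e > 0"
  obtain C where C: "\<And>M K. norm (sum f {M..<K}) \<le> C / real (Suc M)"
    using assms by (auto simp: small_tails_def)
  have "(\<lambda>M. C / real (Suc M)) \<longlonglongrightarrow> 0" by real_asymp
  then have "eventually (\<lambda>M. C / real (Suc M) < e) sequentially"
    using \<open>e > 0\<close> by (rule order_tendstoD)
  then show "\<exists>N. \<forall>m\<ge>N. \<forall>n. norm (sum f {m..<n}) < e"
    using C unfolding eventually_sequentially by (meson le_less_trans)
qed

lemma small_tails_bound:
  assumes "small_tails f"
  obtains C where "\<And>M. norm (sum f {..<M} - suminf f) \<le> C / real (Suc M)"
proof -
  obtain C where C: "\<And>M K. norm (sum f {M..<K}) \<le> C / real (Suc M)"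
    using assms by (auto simp: small_tails_def)
  have "norm (sum f {..<M} - suminf f) \<le> C / real (Suc M)" for M
  proof (rule Lim_bounded)
    show "(\<lambda>K. norm (sum f {..<M} - sum f {..<K})) \<longlonglongrightarrow> norm (sum f {..<M} - suminf f)"
      by (intro tendsto_intros summable_LIMSEQ small_tails_imp_summable assms)
    show "\<forall>K\<ge>M. norm (sum f {..<M} - sum f {..<K}) \<le> C / real (Suc M)"
    proof (intro allI impI)
      fix K assume "M \<le> K"
      then have "sum f {..<K} = sum f {..<M} + sum f {M..<K}"
        using sum.atLeastLessThan_concat[of 0 M K f] by (simp add: lessThan_atLeast0)
      then show "norm (sum f {..<M} - sum f {..<K}) \<le> C / real (Suc M)" 
        using C[of M K] by simp
    qed
  qed
  then show ?thesis by (rule that)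
qed

text \<open>Telescoping: \<open>1 / s ^ 2 \<le> 2 / (s * (s + 1)) = 2 / s - 2 / (s + 1)\<close> for
  \<open>s \<ge> 1\<close>, whence the constant 2.\<close>

lemma sum_inverse_squares_tail:
  "(\<Sum>n=M..<K. 1 / real (Suc n) ^ 2) \<le> 2 / real (Suc M)"
proof (cases "M \<le> K")
  case True
  then have "(\<Sum>n=M..<K. 1 / real (Suc n) ^ 2) \<le> 2 / real (Suc M) - 2 / real (Suc K)"
  proof (induction K rule: dec_induct)
    case (step K)
    have "1 / real (Suc K) ^ 2 \<le> 2 / real (Suc K) - 2 / real (Suc (Suc K))"
    proof -
      define s where "s = real (Suc K)"
      have s: "s \<ge> 1" by (simp add: s_def)
      have "1 / s ^ 2 = 2 / (s * (2 * s))" by (simp add: power2_eq_square)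
      also have "\<dots> \<le> 2 / (s * (s + 1))"
        using s by (intro divide_left_mono mult_left_mono mult_pos_pos) auto
      also have "\<dots> = 2 / s - 2 / (s + 1)" using s by (simp add: field_simps)
      finally show ?thesis by (simp add: s_def add.commute)
    qed
    then show ?case using step by simp
  qed auto
  also have "\<dots> \<le> 2 / real (Suc M)" by simp
  finally show ?thesis .
qed auto

lemma small_tails_absI:
  assumes "\<And>n. norm (f n) \<le> C / real (Suc n) ^ 2"
  shows "small_tails f"
  unfolding small_tails_def
proof (intro exI allI)
  fix M K
  have "C \<ge> 0" using order_trans[OF norm_ge_zero assms[of 0]] by simp
  have "norm (sum f {M..<K}) \<le> (\<Sum>n=M..<K. C * (1 / real (Suc n) ^ 2))"
    using assms by (intro sum_norm_le) auto
  also have "\<dots> \<le> C * (2 / real (Suc M))"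
    unfolding sum_distrib_left[symmetric]
    by (intro mult_left_mono sum_inverse_squares_tail \<open>C \<ge> 0\<close>)
  finally show "norm (sum f {M..<K}) \<le> (C * 2) / real (Suc M)" by simp
qed

text \<open>Summation by parts after multiplication by \<open>1 - y\<close>: the two boundary terms
  contribute 2C/(M+1), the increments of \<open>d\<close> another 2C/(M+1) by the tail of the
  inverse squares, and \<open>y \<noteq> 1\<close> allows the division.\<close>

lemma small_tails_dirichletI:
  assumes y: "norm y = 1" "y \<noteq> 1"
    and d: "\<And>n. norm (d n) \<le> C / real (Suc n)"
      "\<And>n. norm (d (Suc n) - d n) \<le> C / real (Suc n) ^ 2"
  shows "small_tails (\<lambda>n. d n * y ^ n)"
  unfolding small_tails_def
proof (intro exI allI)
  fix M K
  have C: "C \<ge> 0" using order_trans[OF norm_ge_zero d(1)[of 0]] by simp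
  show "norm (\<Sum>n=M..<K. d n * y ^ n) \<le> (4 * C / norm (1 - y)) / real (Suc M)"
  proof (cases "M \<le> K")
    case True
    then have "(1 - y) * (\<Sum>n=M..<K. d n * y ^ n) =
        d M * y ^ M - d K * y ^ K + (\<Sum>n=M..<K. (d (Suc n) - d n) * y ^ Suc n)"
    proof (induction K rule: dec_induct)
      case (step K)
      then show ?case
        by (simp add: distrib_left sum.atLeastLessThan_Suc) (simp add: algebra_simps)
    qed auto
    also have "norm \<dots> \<le> (C / real (Suc M) + C / real (Suc M)) + C * 2 / real (Suc M)"
    proof (rule norm_triangle_mono)
      have "norm (d K) \<le> C / real (Suc K)" by (rule d)
      also have "\<dots> \<le> C / real (Suc M)" using True C by (intro divide_left_mono) auto
      finally show "norm (d M * y ^ M - d K * y ^ K) \<le> C / real (Suc M) + C / real (Suc M)"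
        using d(1)[of M] y(1) by (intro norm_triangle_le_diff add_mono) (auto simp: norm_mult norm_power)
      have "norm (\<Sum>n=M..<K. (d (Suc n) - d n) * y ^ Suc n) \<le> (\<Sum>n=M..<K. C * (1 / real (Suc n) ^ 2))"
        using d(2) y(1) by (intro sum_norm_le) (simp add: norm_mult norm_power)
      also have "\<dots> \<le> C * (2 / real (Suc M))"
        unfolding sum_distrib_left[symmetric] by (intro mult_left_mono sum_inverse_squares_tail C)
      finally show "norm (\<Sum>n=M..<K. (d (Suc n) - d n) * y ^ Suc n) \<le> C * 2 / real (Suc M)" by simp
    qed
    also have "\<dots> = 4 * C / real (Suc M)"
      by (simp add: add_divide_distrib[symmetric])
    finally show ?thesis using y by (simp add: norm_mult pos_le_divide_eq mult_ac)
  qed (use C in auto)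
qed

text \<open>For m >= 2 the terms are O(1/n^2) and boundedness of \<open>c\<close> suffices. For m =
  1 the oscillation of \<open>y ^ n\<close> has to be used, and slow variation of \<open>c\<close>
  makes the increments of \<open>c n / (n + b)\<close> as small as O(1/n^2).\<close>

lemma small_tails_slow:
  assumes "slow c" and b: "\<And>n. of_nat n + b \<noteq> 0" and "m \<ge> 1"
    and y: "norm y = 1" "(m, y) \<noteq> (1, 1)"
  shows "small_tails (\<lambda>n. c n * y ^ n / (of_nat n + b) ^ m)"
proof (cases "m = 1")
  case False
  then have "m \<ge> 2" using \<open>m \<ge> 1\<close> by simp
  obtain B where B: "B \<ge> 1" "\<And>n. norm (1 / (of_nat n + b) ^ m) \<le> B / real (Suc n) ^ m"
    using recip_shift_power_bound[of b] b by blast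
  obtain C where C: "\<And>n. norm (c n) \<le> C" using assms(1) by (auto simp: slow_def)
  have "C \<ge> 0" using C[of 0] norm_ge_zero order_trans by blast
  show ?thesis
  proof (rule small_tails_absI)
    fix n
    have "norm (c n * y ^ n / (of_nat n + b) ^ m) = norm (c n) * norm (1 / (of_nat n + b) ^ m)"
      using y by (simp add: norm_mult norm_divide norm_power)
    also have "\<dots> \<le> C * (B / real (Suc n) ^ m)"
      by (intro mult_mono C B \<open>C \<ge> 0\<close>) auto
    also have "\<dots> \<le> C * (B / real (Suc n) ^ 2)"
      using \<open>m \<ge> 2\<close> \<open>C \<ge> 0\<close> B(1)
      by (intro mult_left_mono divide_left_mono power_increasing) auto
    finally show "norm (c n * y ^ n / (of_nat n + b) ^ m) \<le> C * B / real (Suc n) ^ 2" by simp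
  qed
next
  case True
  then have "y \<noteq> 1" using y by auto
  obtain B where B: "B \<ge> 1" "\<And>n. norm (1 / (of_nat n + b)) \<le> B / real (Suc n)"
    using recip_shift_bound[of b] b by blast
  obtain C where C: "\<And>n. norm (c n) \<le> C" "\<And>n. norm (c (Suc n) - c n) \<le> C / real (Suc n)"
    using assms(1) by (auto simp: slow_def)
  have "C \<ge> 0" using C(1)[of 0] norm_ge_zero order_trans by blast
  have 1: "norm (c n / (of_nat n + b)) \<le> (C * B + C * B * B) / real (Suc n)" for n
  proof -
    have "norm (c n / (of_nat n + b)) = norm (c n) * norm (1 / (of_nat n + b))"
      by (simp add: norm_divide)
    also have "\<dots> \<le> C * (B / real (Suc n))" by (intro mult_mono C B \<open>C \<ge> 0\<close>) auto
    also have "\<dots> \<le> (C * B + C * B * B) / real (Suc n)"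
      using \<open>C \<ge> 0\<close> B(1) by (simp add: divide_simps)
    finally show ?thesis .
  qed
  have 2: "norm (c (Suc n) / (of_nat (Suc n) + b) - c n / (of_nat n + b)) \<le> (C * B + C * B * B) / real (Suc n) ^ 2" for n
  proof -
    have B': "norm (1 / (of_nat (Suc n) + b)) \<le> B / real (Suc n)"
      by (rule order_trans[OF B(2)]) (use B(1) in \<open>auto intro!: divide_left_mono\<close>)
    \<comment> \<open>The increment splits into the variation of \<open>c\<close> and that of the
      reciprocal, which give the summands \<open>C * B\<close> and \<open>C * B * B\<close> of the
      constant.\<close>
    have "c (Suc n) / (of_nat (Suc n) + b) - c n / (of_nat n + b) =
      (c (Suc n) - c n) * (1 / (of_nat (Suc n) + b)) -
      c n * (1 / (of_nat (Suc n) + b)) * (1 / (of_nat n + b))"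
      using b[of n] b[of "Suc n"] by (simp add: divide_simps) (simp add: algebra_simps)
    also have "norm \<dots> \<le> (C / real (Suc n)) * (B / real (Suc n)) + C * (B / real (Suc n)) * (B / real (Suc n))"
      unfolding norm_mult using \<open>C \<ge> 0\<close> B(1)
      by (intro norm_triangle_le_diff add_mono; unfold norm_mult; intro mult_mono C B B' mult_nonneg_nonneg norm_ge_zero divide_nonneg_nonneg) auto
    also have "\<dots> = (C * B + C * B * B) / real (Suc n) ^ 2"
      by (simp add: power2_eq_square add_divide_distrib)
    finally show ?thesis .
  qed
  have "small_tails (\<lambda>n. c n / (of_nat n + b) * y ^ n)"
    by (rule small_tails_dirichletI[OF y(1) \<open>y \<noteq> 1\<close> 1 2])
  then show ?thesis using True by simp
qed

section \<open>Partial zeta sums and their distance to the polylogarithm\<close>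

lemma zeta_partial_eq: "zeta_partial M p w = (\<Sum>n<M. w ^ Suc n / of_nat (Suc n) ^ p)"
  unfolding zeta_partial_def by (rule sum.reindex_bij_witness[of _ Suc "\<lambda>n. n - 1"]) auto

lemma zeta_partial_0 [simp]: "zeta_partial 0 p w = 0"
  by (simp add: zeta_partial_def)

lemma zeta_partial_bound:
  assumes "p \<ge> 1" "norm w = 1" "(p, w) \<noteq> (1, 1)"
  obtains C where "\<And>M. norm (zeta_partial M p w - Li p w) \<le> C / real (Suc M)"
proof -
  have nz: "of_nat n + (1 :: complex) \<noteq> 0" for n
    by (metis of_nat_Suc of_nat_neq_0 add.commute)
  have "small_tails (\<lambda>n. w * w ^ n / (of_nat n + 1) ^ p)"
    using nz assms by (intro small_tails_slow) auto
  then have "small_tails (\<lambda>n. w ^ Suc n / of_nat (Suc n) ^ p)"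
    by (simp add: add.commute)
  then show ?thesis
    using small_tails_bound that unfolding zeta_partial_eq Li_def by blast
qed

text \<open>Boundedness follows from convergence; the increment is a single term of modulus at most
  1/(n+1), absorbed by the \<open>+ 1\<close> in the constant.\<close>

lemma slow_zeta_partial:
  assumes "p \<ge> 1" "norm w = 1" "(p, w) \<noteq> (1, 1)"
  shows "slow (\<lambda>n. zeta_partial n p w)"
proof -
  obtain C where C: "\<And>M. norm (zeta_partial M p w - Li p w) \<le> C / real (Suc M)"
    using zeta_partial_bound assms by blast
  have "C \<ge> 0" using order_trans[OF norm_ge_zero C[of 0]] by simp
  have "norm (zeta_partial n p w) \<le> C + norm (Li p w) + 1" for n
  proof -
    have "norm (zeta_partial n p w) \<le> norm (zeta_partial n p w - Li p w) + norm (Li p w)"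
      using norm_triangle_sub by (metis add.commute)
    moreover have "C / real (Suc n) \<le> C / 1" using \<open>C \<ge> 0\<close> by (intro divide_left_mono) auto
    ultimately show ?thesis using C[of n] by simp
  qed
  moreover have "norm (zeta_partial (Suc n) p w - zeta_partial n p w) \<le> (C + norm (Li p w) + 1) / real (Suc n)" for n
  proof -
    have "norm (zeta_partial (Suc n) p w - zeta_partial n p w) = 1 / real (Suc n) ^ p"
      using assms(2) by (simp add: zeta_partial_eq norm_divide norm_power norm_mult del: of_nat_Suc)
    also have "\<dots> \<le> 1 / real (Suc n) ^ 1"
      using assms(1) by (intro divide_left_mono power_increasing) auto
    also have "\<dots> \<le> (C + norm (Li p w) + 1) / real (Suc n)"
      using \<open>C \<ge> 0\<close> by (simp add: divide_right_mono)
    finally show ?thesis .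
  qed
  ultimately show ?thesis unfolding slow_def by blast
qed

section \<open>Truncation errors\<close>

text \<open>A truncation error of this size survives multiplication, and it is summable against a weight
  $O(1/(n+1))$; a uniform bound would fail, as the truncation is poor for $n$ near $N$.\<close>

definition close :: "(nat \<Rightarrow> nat \<Rightarrow> complex) \<Rightarrow> (nat \<Rightarrow> complex) \<Rightarrow> bool" where
  "close u v \<longleftrightarrow> (\<exists>C. \<forall>N n. n \<le> N \<longrightarrow>
     norm (u N n - v n) \<le> C / real (Suc (N - n)) \<and> norm (v n) \<le> C)"

lemma closeE:
  assumes "close u v"
  obtains C where "C \<ge> 0" "\<And>N n. n \<le> N \<Longrightarrow> norm (u N n - v n) \<le> C / real (Suc (N - n))"
    "\<And>n. norm (v n) \<le> C"
proof -
  obtain C where C: "\<And>N n. n \<le> N \<Longrightarrow> norm (u N n - v n) \<le> C / real (Suc (N - n)) \<and> norm (v n) \<le> C"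
    using assms by (auto simp: close_def)
  moreover have "C \<ge> 0" using C[of 0 0] norm_ge_zero order_trans by blast
  ultimately show ?thesis using that by blast
qed

lemma closeI:
  assumes "\<And>N n. n \<le> N \<Longrightarrow> norm (u N n - v n) \<le> C / real (Suc (N - n))"
    and "\<And>n. norm (v n) \<le> D"
  shows "close u v"
  unfolding close_def
proof (intro exI allI impI conjI)
  fix N n :: nat assume "n \<le> N"
  then have "norm (u N n - v n) \<le> C / real (Suc (N - n))" by (rule assms)
  also have "\<dots> \<le> max C D / real (Suc (N - n))" by (intro divide_right_mono) auto
  finally show "norm (u N n - v n) \<le> max C D / real (Suc (N - n))" .
  show "norm (v n) \<le> max C D" using assms(2)[of n] by simp
qed

lemma close_refl:
  assumes "\<And>n. norm (v n) \<le> C"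
  shows "close (\<lambda>N. v) v"
  using assms by (intro closeI[where C = 0]) auto

lemma close_const [simp, intro]: "close (\<lambda>N n. c) (\<lambda>n. c)"
  by (rule close_refl[of _ "norm c"]) auto

lemma close_add:
  assumes "close u v" "close u' v'"
  shows "close (\<lambda>N n. u N n + u' N n) (\<lambda>n. v n + v' n)"
proof -
  obtain C where C: "\<And>N n. n \<le> N \<Longrightarrow> norm (u N n - v n) \<le> C / real (Suc (N - n))" "\<And>n. norm (v n) \<le> C"
    using assms(1) by (rule closeE) blast
  obtain D where D: "\<And>N n. n \<le> N \<Longrightarrow> norm (u' N n - v' n) \<le> D / real (Suc (N - n))" "\<And>n. norm (v' n) \<le> D"
    using assms(2) by (rule closeE) blast
  show ?thesis
  proof (rule closeI)
    fix N n :: nat assume "n \<le> N"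
    have "norm ((u N n + u' N n) - (v n + v' n)) \<le> norm (u N n - v n) + norm (u' N n - v' n)"
      by (rule norm_diff_triangle_ineq)
    also have "\<dots> \<le> (C + D) / real (Suc (N - n))"
      unfolding add_divide_distrib by (intro add_mono C D \<open>n \<le> N\<close>)
    finally show "norm ((u N n + u' N n) - (v n + v' n)) \<le> (C + D) / real (Suc (N - n))" .
  next
    fix n
    show "norm (v n + v' n) \<le> C + D" by (intro norm_triangle_mono C D)
  qed
qed

lemma close_mult:
  assumes "close u v" "close u' v'"
  shows "close (\<lambda>N n. u N n * u' N n) (\<lambda>n. v n * v' n)"
proof -
  obtain C where C0: "C \<ge> 0" and C: "\<And>N n. n \<le> N \<Longrightarrow> norm (u N n - v n) \<le> C / real (Suc (N - n))" "\<And>n. norm (v n) \<le> C"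
    using assms(1) by (rule closeE) blast
  obtain D where D0: "D \<ge> 0" and D: "\<And>N n. n \<le> N \<Longrightarrow> norm (u' N n - v' n) \<le> D / real (Suc (N - n))" "\<And>n. norm (v' n) \<le> D"
    using assms(2) by (rule closeE) blast
  show ?thesis
  proof (rule closeI)
    fix N n :: nat assume "n \<le> N"
    \<comment> \<open>For n <= N the error never exceeds \<open>D\<close>, so the approximants are
      bounded as well; this is where the 3 in the final constant comes from.\<close>
    have u': "norm (u' N n) \<le> 2 * D"
    proof -
      have "norm (u' N n) \<le> norm (u' N n - v' n) + norm (v' n)"
        by (metis add.commute norm_triangle_sub)
      also have "norm (u' N n - v' n) \<le> D / real (Suc (N - n))" by (rule D) fact
      also have "\<dots> \<le> D / 1" using D0 by (intro divide_left_mono) auto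
      finally show ?thesis using D(2)[of n] by simp
    qed
    have "u N n * u' N n - v n * v' n = (u N n - v n) * u' N n + v n * (u' N n - v' n)"
      by (simp add: algebra_simps)
    also have "norm \<dots> \<le> C / real (Suc (N - n)) * (2 * D) + C * (D / real (Suc (N - n)))"
      by (rule norm_triangle_mono; unfold norm_mult; intro mult_mono C D u' \<open>n \<le> N\<close> norm_ge_zero C0 D0 divide_nonneg_nonneg of_nat_0_le_iff)
    also have "\<dots> = (3 * C * D) / real (Suc (N - n))"
      by (simp add: add_divide_distrib[symmetric])
    finally show "norm (u N n * u' N n - v n * v' n) \<le> (3 * C * D) / real (Suc (N - n))" .
  next
    fix n
    show "norm (v n * v' n) \<le> C * D"
      unfolding norm_mult by (intro mult_mono C D C0 norm_ge_zero)
  qed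
qed

lemma close_sum:
  assumes "\<And>i. i \<in> I \<Longrightarrow> close (u i) (v i)"
  shows "close (\<lambda>N n. \<Sum>i\<in>I. u i N n) (\<lambda>n. \<Sum>i\<in>I. v i n)"
  using assms
proof (induction I rule: infinite_finite_induct)
  case (insert i I)
  then show ?case using close_add[of "u i" "v i"] by simp
qed auto

text \<open>The product of the two rates is the summand of the reciprocal convolution, whose sum
  tends to 0.\<close>

lemma close_sum_tendsto:
  assumes "close u v" and h: "\<And>n. norm (h n) \<le> B / real (Suc n)"
  shows "(\<lambda>N. (\<Sum>n\<le>N. u N n * h n) - (\<Sum>n\<le>N. v n * h n)) \<longlonglongrightarrow> 0"
proof -
  obtain C where C0: "C \<ge> 0" and C: "\<And>N n. n \<le> N \<Longrightarrow> norm (u N n - v n) \<le> C / real (Suc (N - n))"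
    using assms(1) by (rule closeE) blast
  have bound: "norm ((\<Sum>n\<le>N. u N n * h n) - (\<Sum>n\<le>N. v n * h n)) \<le>
      C * B * (\<Sum>n\<le>N. 1 / (real (Suc n) * real (Suc (N - n))))" for N
  proof -
    have "(\<Sum>n\<le>N. u N n * h n) - (\<Sum>n\<le>N. v n * h n) = (\<Sum>n\<le>N. (u N n - v n) * h n)"
      by (simp add: sum_subtractf left_diff_distrib)
    also have "norm \<dots> \<le> (\<Sum>n\<le>N. C * B * (1 / (real (Suc n) * real (Suc (N - n)))))"
    proof (rule sum_norm_le)
      fix n assume "n \<in> {..N}"
      then have "norm ((u N n - v n) * h n) \<le> (C / real (Suc (N - n))) * (B / real (Suc n))"
        unfolding norm_mult by (intro mult_mono C h norm_ge_zero divide_nonneg_nonneg C0) auto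
      then show "norm ((u N n - v n) * h n) \<le> C * B * (1 / (real (Suc n) * real (Suc (N - n))))"
        by (simp add: mult.commute)
    qed
    finally show ?thesis by (simp only: sum_distrib_left)
  qed
  have "(\<lambda>N. C * B * (\<Sum>n\<le>N. 1 / (real (Suc n) * real (Suc (N - n))))) \<longlonglongrightarrow> C * B * 0"
    by (intro tendsto_mult tendsto_const sum_recip_convolution_tendsto_0)
  then have lim: "(\<lambda>N. C * B * (\<Sum>n\<le>N. 1 / (real (Suc n) * real (Suc (N - n))))) \<longlonglongrightarrow> 0"
    by (simp only: mult_zero_right)
  show ?thesis
    by (rule Lim_null_comparison[OF always_eventually lim]) (intro allI bound)
qed

text \<open>Coefficientwise, with no uniformity in k: the residue at an integer -n involves only the
  coefficients up to p1 + p2, so finitely many constants occur.\<close>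

definition fps_close :: "(nat \<Rightarrow> nat \<Rightarrow> complex fps) \<Rightarrow> (nat \<Rightarrow> complex fps) \<Rightarrow> bool" where
  "fps_close U V \<longleftrightarrow> (\<forall>k. close (\<lambda>N n. fps_nth (U N n) k) (\<lambda>n. fps_nth (V n) k))"

lemma fps_close_const [simp, intro]: "fps_close (\<lambda>N n. F) (\<lambda>n. F)"
  by (auto simp: fps_close_def)

lemma fps_close_add:
  "fps_close U V \<Longrightarrow> fps_close U' V' \<Longrightarrow> fps_close (\<lambda>N n. U N n + U' N n) (\<lambda>n. V n + V' n)"
  by (auto simp: fps_close_def intro: close_add)

lemma fps_close_mult:
  "fps_close U V \<Longrightarrow> fps_close U' V' \<Longrightarrow> fps_close (\<lambda>N n. U N n * U' N n) (\<lambda>n. V n * V' n)"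
  unfolding fps_close_def fps_mult_nth by (intro allI close_sum close_mult; blast)

text \<open>\<open>V n\<close> may keep changing with n, so the comparison is made pole by pole;
  \<open>H\<close> carries the decay and \<open>c\<close> is the unimodular twist. A coefficient of
  the product is a finite sum, to each term of which the scalar statement applies.\<close>

lemma fps_close_sum_tendsto:
  assumes "fps_close U V" and H: "\<And>k. \<exists>B. \<forall>n. norm (fps_nth (H n) k) \<le> B / real (Suc n)"
    and c: "\<And>n. norm (c n) = 1"
  shows "(\<lambda>N. (\<Sum>n\<le>N. c n * fps_nth (U N n * H n) m) - (\<Sum>n\<le>N. c n * fps_nth (V n * H n) m)) \<longlonglongrightarrow> 0"
proof -
  have "(\<lambda>N. \<Sum>i=0..m. (\<Sum>n\<le>N. fps_nth (U N n) i * (c n * fps_nth (H n) (m - i))) -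
      (\<Sum>n\<le>N. fps_nth (V n) i * (c n * fps_nth (H n) (m - i)))) \<longlonglongrightarrow> (\<Sum>i=0..m. 0)"
  proof (rule tendsto_sum)
    fix i
    obtain B where "\<And>n. norm (fps_nth (H n) (m - i)) \<le> B / real (Suc n)" using H by blast
    then have 1: "\<And>n. norm (c n * fps_nth (H n) (m - i)) \<le> B / real (Suc n)" using c by (simp add: norm_mult)
    have 2: "close (\<lambda>N n. fps_nth (U N n) i) (\<lambda>n. fps_nth (V n) i)"
      using assms(1) by (simp add: fps_close_def)
    show "(\<lambda>N. (\<Sum>n\<le>N. fps_nth (U N n) i * (c n * fps_nth (H n) (m - i))) -
      (\<Sum>n\<le>N. fps_nth (V n) i * (c n * fps_nth (H n) (m - i)))) \<longlonglongrightarrow> 0"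
      by (rule close_sum_tendsto[OF 2 1])
  qed
  moreover have "(\<Sum>i=0..m. (\<Sum>n\<le>N. fps_nth (W n) i * (c n * fps_nth (H n) (m - i)))) =
    (\<Sum>n\<le>N. c n * fps_nth (W n * H n) m)" for W :: "nat \<Rightarrow> complex fps" and N
    by (subst sum.swap) (simp add: fps_mult_nth sum_distrib_left mult.left_commute)
  ultimately show ?thesis by (simp add: sum_subtractf)
qed

text \<open>\<open>bilateral_fps u p M K\<close> is the expansion at $t=0$ of
  $\sum_{1\le j\le M}u^j/(t+j)^p+\sum_{1\le j\le K}u^{-j}/(t-j)^p$.\<close>

definition bilateral_fps :: "complex \<Rightarrow> nat \<Rightarrow> nat \<Rightarrow> nat \<Rightarrow> complex fps" where
  "bilateral_fps u p M K = Abs_fps (\<lambda>k. of_nat ((k + p - 1) choose (p - 1)) *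
     ((-1) ^ k * zeta_partial M (k + p) u + (-1) ^ p * zeta_partial K (k + p) (inverse u)))"

text \<open>Only the right half is completed. To the left of the pole -n the series phi_p has
  exactly n terms whatever the truncation, so \<open>K = n\<close> is already exact; these finite
  sums are the source of the R-sums with parameter -a.\<close>

definition bilateral_lim_fps :: "complex \<Rightarrow> nat \<Rightarrow> nat \<Rightarrow> complex fps" where
  "bilateral_lim_fps u p K = Abs_fps (\<lambda>k. of_nat ((k + p - 1) choose (p - 1)) *
     ((-1) ^ k * Li (k + p) u + (-1) ^ p * zeta_partial K (k + p) (inverse u)))"

text \<open>The length is an arbitrary \<open>f N n\<close> from N - n upwards because two cuts
  occur, N - n and N + 1 + n.\<close>

lemma close_zeta_partial:
  assumes "p \<ge> 1" "norm w = 1" "(p, w) \<noteq> (1, 1)" and f: "\<And>N n. n \<le> N \<Longrightarrow> N - n \<le> f N n"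
  shows "close (\<lambda>N n. zeta_partial (f N n) p w) (\<lambda>n. Li p w)"
proof -
  obtain C where C: "\<And>M. norm (zeta_partial M p w - Li p w) \<le> C / real (Suc M)"
    using zeta_partial_bound assms(1-3) by blast
  have "C \<ge> 0" using order_trans[OF norm_ge_zero C[of 0]] by simp
  show ?thesis
  proof (rule closeI)
    fix N n :: nat assume "n \<le> N"
    have "norm (zeta_partial (f N n) p w - Li p w) \<le> C / real (Suc (f N n))" by (rule C)
    also have "\<dots> \<le> C / real (Suc (N - n))"
      using f[OF \<open>n \<le> N\<close>] \<open>C \<ge> 0\<close> by (intro divide_left_mono) auto
    finally show "norm (zeta_partial (f N n) p w - Li p w) \<le> C / real (Suc (N - n))" .
  qed auto
qed

lemma exponent_side_condition:
  fixes p k :: nat and u :: complex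
  assumes "p \<ge> 1" "(p, u) \<noteq> (1, 1)"
  shows "(k + p, u) \<noteq> (1, 1)" "(k + p, inverse u) \<noteq> (1, 1)"
proof -
  have "k + p = 1 \<Longrightarrow> p = 1" using assms(1) by linarith
  then show "(k + p, u) \<noteq> (1, 1)" "(k + p, inverse u) \<noteq> (1, 1)"
    using assms(2) by (metis Pair_inject inverse_eq_1_iff)+
qed

lemma bounded_zeta_partial:
  assumes "p \<ge> 1" "norm w = 1" "(p, w) \<noteq> (1, 1)"
  obtains C where "\<And>n. norm (zeta_partial n p w) \<le> C"
  using slow_zeta_partial[OF assms] unfolding slow_def by metis

lemma fps_close_bilateral:
  assumes "p \<ge> 1" "norm u = 1" "(p, u) \<noteq> (1, 1)"
  shows "fps_close (\<lambda>N n. bilateral_fps u p (N - n) n) (bilateral_lim_fps u p)"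
  unfolding fps_close_def
proof
  fix k
  have u': "norm (inverse u) = 1" using assms by (simp add: norm_inverse)
  have side: "k + p \<ge> 1" "(k + p, u) \<noteq> (1, 1)" "(k + p, inverse u) \<noteq> (1, 1)"
    using exponent_side_condition assms by auto
  obtain C where C: "\<And>n. norm (zeta_partial n (k + p) (inverse u)) \<le> C"
    using bounded_zeta_partial[OF side(1) u' side(3)] by blast
  have "close (\<lambda>N n. zeta_partial (N - n) (k + p) u) (\<lambda>n. Li (k + p) u)"
    by (rule close_zeta_partial) (use assms side in auto)
  moreover have "close (\<lambda>N n. zeta_partial n (k + p) (inverse u)) (\<lambda>n. zeta_partial n (k + p) (inverse u))"
    by (rule close_refl) (rule C)
  ultimately show "close (\<lambda>N n. fps_nth (bilateral_fps u p (N - n) n) k) (\<lambda>n. fps_nth (bilateral_lim_fps u p n) k)"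
    unfolding bilateral_fps_def bilateral_lim_fps_def fps_nth_Abs_fps
    by (intro close_mult close_add close_const)
qed

text \<open>The kernel extends in both directions, so both halves become infinite series and the
  limit is the same at every pole; \<open>x \<noteq> 1\<close> makes both converge at k = 0.\<close>

lemma fps_close_bilateral_kernel:
  assumes "norm x = 1" "x \<noteq> 1"
  shows "fps_close (\<lambda>N n. bilateral_fps x 1 (N - n) (N + 1 + n)) (\<lambda>n. Abs_fps (D_coeff x))"
  unfolding fps_close_def
proof
  fix k
  have "close (\<lambda>N n. zeta_partial (N - n) (k + 1) x) (\<lambda>n. Li (k + 1) x)"
    by (rule close_zeta_partial) (use assms in auto)
  moreover have "close (\<lambda>N n. zeta_partial (N + 1 + n) (k + 1) (inverse x)) (\<lambda>n. Li (k + 1) (inverse x))"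
    by (rule close_zeta_partial) (use assms in \<open>auto simp: norm_inverse inverse_eq_1_iff\<close>)
  ultimately have "close (\<lambda>N n. of_nat ((k + 1 - 1) choose (1 - 1)) *
      ((-1) ^ k * zeta_partial (N - n) (k + 1) x + (-1) ^ 1 * zeta_partial (N + 1 + n) (k + 1) (inverse x)))
     (\<lambda>n. of_nat ((k + 1 - 1) choose (1 - 1)) * ((-1) ^ k * Li (k + 1) x + (-1) ^ 1 * Li (k + 1) (inverse x)))"
    by (intro close_mult close_add close_const)
  then show "close (\<lambda>N n. fps_nth (bilateral_fps x 1 (N - n) (N + 1 + n)) k) (\<lambda>n. fps_nth (Abs_fps (D_coeff x)) k)"
    unfolding bilateral_fps_def fps_nth_Abs_fps by (simp add: D_coeff_def)
qed

section \<open>Coefficients of products of three and four series\<close>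

lemma fps_mult3_nth:
  fixes A B C :: "complex fps"
  shows "fps_nth (A * B * C) m =
    (\<Sum>(k1, k2) \<in> {(k1, k2). k1 + k2 \<le> m}. fps_nth A k1 * fps_nth B k2 * fps_nth C (m - k1 - k2))"
proof -
  have "fps_nth (A * B * C) m = (\<Sum>i=0..m. \<Sum>j=0..m - i. fps_nth A i * fps_nth B j * fps_nth C (m - i - j))"
    unfolding mult.assoc by (simp add: fps_mult_nth sum_distrib_left mult.left_commute)
  also have "\<dots> = (\<Sum>(i, j)\<in>Sigma {0..m} (\<lambda>i. {0..m - i}). fps_nth A i * fps_nth B j * fps_nth C (m - i - j))"
    by (simp add: sum.Sigma)
  also have "Sigma {0..m} (\<lambda>i. {0..m - i}) = {(k1, k2). k1 + k2 \<le> m}" by auto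
  finally show ?thesis .
qed

lemma fps_mult3_nth':
  fixes A B C :: "complex fps"
  shows "fps_nth (A * B * C) m =
    (\<Sum>(k1, k2, k3) \<in> {(k1, k2, k3). k1 + k2 + k3 = m}. fps_nth A k1 * fps_nth B k2 * fps_nth C k3)"
  unfolding fps_mult3_nth
  by (rule sum.reindex_bij_witness[of _ "\<lambda>(k1, k2, k3). (k1, k2)" "\<lambda>(k1, k2). (k1, k2, m - k1 - k2)"])
     (clarsimp; linarith?)+

text \<open>Each bracket is a singular factor cleared of its denominator. Of the eight products
  formed from the three brackets, the one taking all three regular parts starts at degree p1 + p2 +
  1 and drops out; the other seven are the seven groups of terms that the poles -n contribute to the
  identity.\<close>

lemma polar_product_nth:
  fixes D E G H :: "complex fps"
  assumes "p1 \<ge> 1" "p2 \<ge> 1"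
  shows "fps_nth ((1 + fps_X * D) * (1 + fps_X ^ p1 * E) * (1 + fps_X ^ p2 * G) * H) (p1 + p2) =
      fps_nth H (p1 + p2)
    + (\<Sum>k=0..p1. fps_nth G k * fps_nth H (p1 - k))
    + (\<Sum>k=0..p2. fps_nth E k * fps_nth H (p2 - k))
    + (\<Sum>k=0..p1 + p2 - 1. fps_nth D k * fps_nth H (p1 + p2 - 1 - k))
    + fps_nth E 0 * fps_nth G 0 * fps_nth H 0
    + (\<Sum>(k1, k2) \<in> {(k1, k2). k1 + k2 \<le> p1 - 1}. fps_nth D k1 * fps_nth G k2 * fps_nth H (p1 - 1 - k1 - k2))
    + (\<Sum>(k1, k2) \<in> {(k1, k2). k1 + k2 \<le> p2 - 1}. fps_nth D k1 * fps_nth E k2 * fps_nth H (p2 - 1 - k1 - k2))"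
proof -
  have "(1 + x * D) * (1 + P * E) * (1 + Q * G) * H =
      H + Q * (G * H) + P * (E * H) + x * (D * H) + P * Q * (E * G * H) + Q * x * (D * G * H)
      + P * x * (D * E * H) + P * Q * x * (D * E * G * H)" for x P Q :: "complex fps"
    by algebra
  \<comment> \<open>\<open>fps_X\<close> enters as a power so that the single rule for
    multiplication by a power of \<open>fps_X\<close> handles every shift.\<close>
  from this[of "fps_X ^ 1" "fps_X ^ p1" "fps_X ^ p2"]
  have eq: "(1 + fps_X * D) * (1 + fps_X ^ p1 * E) * (1 + fps_X ^ p2 * G) * H =
      H + fps_X ^ p2 * (G * H) + fps_X ^ p1 * (E * H) + fps_X ^ 1 * (D * H)
      + fps_X ^ (p1 + p2) * (E * G * H) + fps_X ^ (p2 + 1) * (D * G * H)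
      + fps_X ^ (p1 + 1) * (D * E * H) + fps_X ^ (p1 + p2 + 1) * (D * E * G * H)"
    by (simp only: power_add power_one_right)
  have arith: "p1 + p2 - (p2 + 1) = p1 - 1" "p1 + p2 - (p1 + 1) = p2 - 1"
    "\<not> p1 + p2 < p2 + 1" "\<not> p1 + p2 < p1 + 1" "\<not> p1 + p2 < 1" "p1 + p2 < p1 + p2 + 1"
    "\<not> p1 + p2 < p1 + p2" "\<not> p1 + p2 < p1" "\<not> p1 + p2 < p2" "p1 + p2 - p2 = p1" "p1 + p2 - p1 = p2"
    "p1 + p2 - (p1 + p2) = 0"
    using assms by auto
  have zero: "fps_nth (E * G * H) 0 = fps_nth E 0 * fps_nth G 0 * fps_nth H 0" by simp
  show ?thesis
    by (simp only: eq fps_add_nth fps_X_power_mult_nth arith fps_mult3_nth[of D]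
        fps_mult_nth[of G H] fps_mult_nth[of E H] fps_mult_nth[of D H] zero if_True if_False
        add_0_right)
qed

section \<open>The limiting residues as series\<close>

text \<open>The alternating sign of the series cancels against that of
  \<open>(- c) ^ (k + m)\<close>, leaving \<open>(-1) ^ m\<close> independent of k: hence the
  factors \<open>(-1) ^ q\<close>, \<open>(-1) ^ p1\<close> and \<open>(-1) ^ p2\<close> of the
  identity.\<close>

lemma fps_recip_power_uminus_nth:
  assumes "c \<noteq> 0"
  shows "fps_nth (fps_recip_power (- c) m) k =
    (-1) ^ m * of_nat ((k + m - 1) choose (m - 1)) / c ^ (k + m)"
proof -
  have "(- c) ^ (k + m) = (-1) ^ k * (-1) ^ m * c ^ (k + m)"
    by (metis power_minus power_add)
  moreover have "(-1) ^ k * (-1) ^ k = (1::complex)" "(-1) ^ m * (-1) ^ m = (1::complex)"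
    by (simp_all flip: power_mult_distrib)
  ultimately show ?thesis
    using assms by (simp add: fps_recip_power_def field_simps)
qed

text \<open>The second form is the one met at the poles -n, where the powers start with
  \<open>y ^ 0\<close> and not with \<open>y ^ 1\<close>; the quotient is the factor
  \<open>inverse y\<close> of the identity.\<close>

lemma sums_Li_Hurwitz:
  assumes "norm w = 1" "m \<ge> 1" "(m, w) \<noteq> (1, 1)" and b: "\<And>n. of_nat n + b \<noteq> 0"
  shows "(\<lambda>n. w ^ Suc n / (of_nat n + b) ^ m) sums Li_Hurwitz m w b"
    and "(\<lambda>n. w ^ n / (of_nat n + b) ^ m) sums (inverse w * Li_Hurwitz m w b)"
proof -
  have "small_tails (\<lambda>n. w * w ^ n / (of_nat n + b) ^ m)"
    by (rule small_tails_slow) (use assms in auto)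
  then show *: "(\<lambda>n. w ^ Suc n / (of_nat n + b) ^ m) sums Li_Hurwitz m w b"
    unfolding Li_Hurwitz_def by (auto dest!: small_tails_imp_summable simp: summable_sums_iff)
  have "w \<noteq> 0" using assms by auto
  with sums_mult[OF *, of "inverse w"] 
  show "(\<lambda>n. w ^ n / (of_nat n + b) ^ m) sums (inverse w * Li_Hurwitz m w b)"
    by (simp add: field_simps)
qed

lemma Li_Hurwitz_shift:
  assumes "norm w = 1" "m \<ge> 1" "(m, w) \<noteq> (1, 1)" and b: "\<And>n. of_nat n + b \<noteq> 0"
  shows "Li_Hurwitz m w b = w / b ^ m + w * Li_Hurwitz m w (b + 1)"
proof -
  have b': "of_nat n + (b + 1) \<noteq> 0" for n
    using b[of "Suc n"] by (simp add: add_ac)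
  have "(\<lambda>n. w * (w ^ Suc n / (of_nat n + (b + 1)) ^ m)) sums (w * Li_Hurwitz m w (b + 1))"
    by (intro sums_mult sums_Li_Hurwitz assms b')
  then have "(\<lambda>n. w ^ Suc (Suc n) / (of_nat (Suc n) + b) ^ m) sums (w * Li_Hurwitz m w (b + 1))"
    by (simp add: add_ac)
  then have "(\<lambda>n. w ^ Suc n / (of_nat n + b) ^ m) sums (w * Li_Hurwitz m w (b + 1) + w ^ Suc 0 / (of_nat 0 + b) ^ m)"
    by (subst (asm) sums_Suc_iff)
  with sums_Li_Hurwitz(1)[OF assms(1-3) b] show ?thesis
    by (simp add: sums_unique2 add.commute)
qed

text \<open>Since \<open>c 0 = 0\<close>, a series over n >= 0 already is the series over n >= 1
  that defines an R-sum, with no change of parameter. Partial zeta sums qualify, being empty at n =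
  0.\<close>

lemma slow_series_shift:
  assumes "slow c" "c 0 = 0" "norm w = 1" "m \<ge> 1" "(m, w) \<noteq> (1, 1)" and b: "\<And>n. of_nat n + b \<noteq> 0"
  shows "(\<lambda>n. c n * w ^ n / (of_nat n + b) ^ m) sums (\<Sum>n. c (Suc n) / (of_nat (Suc n) + b) ^ m * w ^ Suc n)"
proof -
  let ?f = "\<lambda>n. c n * w ^ n / (of_nat n + b) ^ m"
  have "summable ?f"
    by (intro small_tails_imp_summable small_tails_slow) (use assms in auto)
  then have "summable (\<lambda>n. ?f (Suc n))" by (subst summable_Suc_iff)
  then have "(\<lambda>n. ?f (Suc n)) sums (\<Sum>n. ?f (Suc n))" by (rule summable_sums)
  then have "?f sums ((\<Sum>n. ?f (Suc n)) + ?f 0)" by (subst (asm) sums_Suc_iff)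
  then show ?thesis using assms(2) by simp
qed

lemma sums_Rsum1:
  assumes "p \<ge> 1" "norm u = 1" "(p, u) \<noteq> (1, 1)" "norm w = 1" "m \<ge> 1" "(m, w) \<noteq> (1, 1)"
    and b: "\<And>n. of_nat n + b \<noteq> 0"
  shows "(\<lambda>n. zeta_partial n p u * w ^ n / (of_nat n + b) ^ m) sums Rsum b [(p, u)] m w"
  using slow_series_shift[OF slow_zeta_partial[OF assms(1-3)] _ assms(4-6) b]
  by (simp add: Rsum_def)

lemma sums_Rsum2:
  assumes "p \<ge> 1" "norm u = 1" "(p, u) \<noteq> (1, 1)" "p' \<ge> 1" "norm u' = 1" "(p', u') \<noteq> (1, 1)"
    and "norm w = 1" "m \<ge> 1" "(m, w) \<noteq> (1, 1)" and b: "\<And>n. of_nat n + b \<noteq> 0"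
  shows "(\<lambda>n. zeta_partial n p u * zeta_partial n p' u' * w ^ n / (of_nat n + b) ^ m)
    sums Rsum b [(p, u), (p', u')] m w"
  using slow_series_shift[OF slow_mult[OF slow_zeta_partial[OF assms(1-3)] slow_zeta_partial[OF assms(4-6)]] _ assms(7-9) b]
  by (simp add: Rsum_def)

text \<open>At the positive pole n + 1 the partial sums have length n. Aligning the two indices
  costs one factor \<open>w\<close> and raises the parameter by one, whence \<open>inverse y\<close>
  and \<open>a + 1\<close> in the identity.\<close>

lemma slow_series_shift':
  assumes "slow c" "c 0 = 0" "norm w = 1" "m \<ge> 1" "(m, w) \<noteq> (1, 1)" and b: "\<And>n. of_nat (Suc n) + b \<noteq> 0"
  shows "(\<lambda>n. c n * w ^ Suc n / (of_nat (Suc n) + b) ^ m)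
    sums (w * (\<Sum>n. c (Suc n) / (of_nat (Suc n) + (b + 1)) ^ m * w ^ Suc n))"
proof -
  have b': "of_nat n + (b + 1) \<noteq> 0" for n using b[of n] by (simp add: add_ac)
  have "(\<lambda>n. w * (c n * w ^ n / (of_nat n + (b + 1)) ^ m))
    sums (w * (\<Sum>n. c (Suc n) / (of_nat (Suc n) + (b + 1)) ^ m * w ^ Suc n))"
    by (intro sums_mult slow_series_shift assms b')
  then show ?thesis by (simp add: add_ac mult_ac)
qed

lemma norm_root_of_unity: "root_of_unity u \<Longrightarrow> norm u = 1"
  unfolding root_of_unity_def
  by (metis norm_ge_zero norm_one norm_power not_gr_zero power_eq_1_iff)

locale twisted_kernel =
  fixes x x1 x2 y a :: complex and p1 p2 q :: nat
  assumes norm_x: "norm x = 1" and norm_x1: "norm x1 = 1" and norm_x2: "norm x2 = 1"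
    and x_neq_1: "x \<noteq> 1" and a: "a \<notin> \<int>"
    and p1: "p1 \<ge> 1" and p2: "p2 \<ge> 1" and q: "q \<ge> 1"
    and y: "y = x * x1 * x2"
    and px1: "(p1, x1) \<noteq> (1, 1)" and px2: "(p2, x2) \<noteq> (1, 1)" and qy: "(q, y) \<noteq> (1, 1)"
begin

lemma norm_y: "norm y = 1"
  by (simp add: y norm_mult norm_x norm_x1 norm_x2)

lemma norm_inverses: "norm (inverse x) = 1" "norm (inverse x1) = 1" "norm (inverse x2) = 1" "norm (inverse y) = 1"
  by (simp_all add: norm_inverse norm_x norm_x1 norm_x2 norm_y)

lemma nonzero: "x \<noteq> 0" "x1 \<noteq> 0" "x2 \<noteq> 0" "y \<noteq> 0"
  using norm_x norm_x1 norm_x2 norm_y by auto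

lemma of_int_add_a_nonzero: "of_int k + a \<noteq> 0"
proof
  assume "of_int k + a = 0"
  then have "a = of_int (- k)" by (simp add: eq_neg_iff_add_eq_0 add.commute)
  then show False using a by auto
qed

lemma add_a_nonzero: "of_nat n + a \<noteq> 0" "of_nat n + - a \<noteq> 0" "a - of_nat n \<noteq> 0" "of_nat n - a \<noteq> 0"
  using of_int_add_a_nonzero[of "int n"] of_int_add_a_nonzero[of "- int n"] by auto

text \<open>The Taylor series of \<open>1 / (s + a) ^ q\<close> at \<open>s = - n\<close>; among the
  factors at this pole it is the one that decays in n.\<close>

definition H :: "nat \<Rightarrow> complex fps" where
  "H n = fps_recip_power (a - of_nat n) q"

lemma H_nth: "fps_nth (H n) j = (-1) ^ q * of_nat ((j + q - 1) choose (q - 1)) / (of_nat n + - a) ^ (j + q)"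
  using fps_recip_power_uminus_nth[of "of_nat n - a" q j] add_a_nonzero[of n] by (simp add: H_def)

lemma exponent_q: "j + q \<ge> 1" "(j + q, y) \<noteq> (1, 1)"
  using q exponent_side_condition(1)[OF q qy] by auto

lemma sums_H:
  "(\<lambda>n. y ^ n * fps_nth (H n) j) sums
     ((-1) ^ q * of_nat ((j + q - 1) choose (q - 1)) * (inverse y * Li_Hurwitz (j + q) y (- a)))"
proof -
  have "(\<lambda>n. (-1) ^ q * of_nat ((j + q - 1) choose (q - 1)) * (y ^ n / (of_nat n + - a) ^ (j + q))) sums
     ((-1) ^ q * of_nat ((j + q - 1) choose (q - 1)) * (inverse y * Li_Hurwitz (j + q) y (- a)))"
    by (intro sums_mult sums_Li_Hurwitz norm_y exponent_q add_a_nonzero)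
  then show ?thesis by (simp add: H_nth mult_ac)
qed

lemma sums_bilateral_H:
  assumes "p \<ge> 1" "norm u = 1" "(p, u) \<noteq> (1, 1)"
  shows "(\<lambda>n. y ^ n * (fps_nth (bilateral_lim_fps u p n) k * fps_nth (H n) j)) sums
     ((-1) ^ q * (of_nat ((k + p - 1) choose (p - 1)) * of_nat ((j + q - 1) choose (q - 1)) *
       ((-1) ^ k * inverse y * Li (k + p) u * Li_Hurwitz (j + q) y (- a) +
        (-1) ^ p * Rsum (- a) [(k + p, inverse u)] (j + q) y)))"
proof -
  have u': "norm (inverse u) = 1" using assms by (simp add: norm_inverse)
  have kp: "k + p \<ge> 1" "(k + p, inverse u) \<noteq> (1, 1)"
    using exponent_side_condition assms by auto
  have 1: "(\<lambda>n. y ^ n / (of_nat n + - a) ^ (j + q)) sums (inverse y * Li_Hurwitz (j + q) y (- a))"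
    by (intro sums_Li_Hurwitz norm_y exponent_q add_a_nonzero)
  have 2: "(\<lambda>n. zeta_partial n (k + p) (inverse u) * y ^ n / (of_nat n + - a) ^ (j + q)) sums
      Rsum (- a) [(k + p, inverse u)] (j + q) y"
    by (intro sums_Rsum1 norm_y exponent_q add_a_nonzero kp u')
  have "(\<lambda>n. (-1) ^ q * of_nat ((k + p - 1) choose (p - 1)) * of_nat ((j + q - 1) choose (q - 1)) *
     ((-1) ^ k * Li (k + p) u * (y ^ n / (of_nat n + - a) ^ (j + q)) +
      (-1) ^ p * (zeta_partial n (k + p) (inverse u) * y ^ n / (of_nat n + - a) ^ (j + q)))) sums
     ((-1) ^ q * of_nat ((k + p - 1) choose (p - 1)) * of_nat ((j + q - 1) choose (q - 1)) *
       ((-1) ^ k * Li (k + p) u * (inverse y * Li_Hurwitz (j + q) y (- a)) +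
        (-1) ^ p * Rsum (- a) [(k + p, inverse u)] (j + q) y))"
    by (intro sums_mult sums_add 1 2)
  then show ?thesis
    by (simp add: H_nth bilateral_lim_fps_def algebra_simps add_divide_distrib)
qed

text \<open>Two constant terms, each a polylogarithm plus a signed partial zeta sum, are multiplied.
  The product of the two partial sums gives the R-sum with parameter -a that the theorem carries on
  its left side.\<close>

lemma sums_bilateral2_H:
  "(\<lambda>n. y ^ n * (fps_nth (bilateral_lim_fps x1 p1 n) 0 * fps_nth (bilateral_lim_fps x2 p2 n) 0 * fps_nth (H n) 0)) sums
     ((-1) ^ q * inverse y * Li p1 x1 * Li p2 x2 * Li_Hurwitz q y (- a)
       + (-1) ^ (q + p2) * Li p1 x1 * Rsum (- a) [(p2, inverse x2)] q y
       + (-1) ^ (q + p1) * Li p2 x2 * Rsum (- a) [(p1, inverse x1)] q y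
       + (-1) ^ (p1 + p2 + q) * Rsum (- a) [(p1, inverse x1), (p2, inverse x2)] q y)"
proof -
  note side = exponent_side_condition(2)[OF p1 px1, of 0, simplified] exponent_side_condition(2)[OF p2 px2, of 0, simplified]
  have 0: "(\<lambda>n. y ^ n / (of_nat n + - a) ^ q) sums (inverse y * Li_Hurwitz q y (- a))"
    by (intro sums_Li_Hurwitz norm_y q qy add_a_nonzero)
  have 1: "(\<lambda>n. zeta_partial n p1 (inverse x1) * y ^ n / (of_nat n + - a) ^ q) sums Rsum (- a) [(p1, inverse x1)] q y"
    by (rule sums_Rsum1) (use side p1 q norm_y norm_inverses qy add_a_nonzero in auto)
  have 2: "(\<lambda>n. zeta_partial n p2 (inverse x2) * y ^ n / (of_nat n + - a) ^ q) sums Rsum (- a) [(p2, inverse x2)] q y"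
    by (rule sums_Rsum1) (use side p2 q norm_y norm_inverses qy add_a_nonzero in auto)
  have 3: "(\<lambda>n. zeta_partial n p1 (inverse x1) * zeta_partial n p2 (inverse x2) * y ^ n / (of_nat n + - a) ^ q) sums
      Rsum (- a) [(p1, inverse x1), (p2, inverse x2)] q y"
    by (rule sums_Rsum2) (use side p1 p2 q norm_y norm_inverses qy add_a_nonzero in auto)
  have "(\<lambda>n. (-1) ^ q * Li p1 x1 * Li p2 x2 * (y ^ n / (of_nat n + - a) ^ q)
       + (-1) ^ (q + p2) * Li p1 x1 * (zeta_partial n p2 (inverse x2) * y ^ n / (of_nat n + - a) ^ q)
       + (-1) ^ (q + p1) * Li p2 x2 * (zeta_partial n p1 (inverse x1) * y ^ n / (of_nat n + - a) ^ q)
       + (-1) ^ (p1 + p2 + q) * (zeta_partial n p1 (inverse x1) * zeta_partial n p2 (inverse x2) * y ^ n / (of_nat n + - a) ^ q))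
     sums ((-1) ^ q * Li p1 x1 * Li p2 x2 * (inverse y * Li_Hurwitz q y (- a))
       + (-1) ^ (q + p2) * Li p1 x1 * Rsum (- a) [(p2, inverse x2)] q y
       + (-1) ^ (q + p1) * Li p2 x2 * Rsum (- a) [(p1, inverse x1)] q y
       + (-1) ^ (p1 + p2 + q) * Rsum (- a) [(p1, inverse x1), (p2, inverse x2)] q y)"
    by (intro sums_mult sums_add 0 1 2 3)
  then show ?thesis
    by (simp add: H_nth bilateral_lim_fps_def algebra_simps add_divide_distrib power_add)
qed

text \<open>The limits, as the truncation is removed, of the residues at $-n$ and (below) at $n+1$.\<close>

definition neg_residue :: "nat \<Rightarrow> complex" where
  "neg_residue n = y ^ n * fps_nth ((1 + fps_X * Abs_fps (D_coeff x)) *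
     (1 + fps_X ^ p1 * bilateral_lim_fps x1 p1 n) * (1 + fps_X ^ p2 * bilateral_lim_fps x2 p2 n) * H n) (p1 + p2)"

lemma sums_neg_residue:
  "neg_residue sums
     ((-1) ^ q * inverse y * of_nat ((q + p1 + p2 - 1) choose (q - 1)) * Li_Hurwitz (q + p1 + p2) y (- a)
       + (-1) ^ q * (\<Sum>k=0..p1.
           of_nat ((k + p2 - 1) choose (p2 - 1)) * of_nat ((q + p1 - k - 1) choose (q - 1))
           * ((-1) ^ k * inverse y * Li (k + p2) x2 * Li_Hurwitz (p1 + q - k) y (- a)
              + (-1) ^ p2 * Rsum (- a) [(k + p2, inverse x2)] (p1 + q - k) y))
       + (-1) ^ q * (\<Sum>k=0..p2.
           of_nat ((k + p1 - 1) choose (p1 - 1)) * of_nat ((q + p2 - k - 1) choose (q - 1))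
           * ((-1) ^ k * inverse y * Li (k + p1) x1 * Li_Hurwitz (p2 + q - k) y (- a)
              + (-1) ^ p1 * Rsum (- a) [(k + p1, inverse x1)] (p2 + q - k) y))
       + (-1) ^ q * inverse y * (\<Sum>k=0..p1 + p2 - 1.
           of_nat ((q + p1 + p2 - k - 2) choose (q - 1)) * D_coeff x k
           * Li_Hurwitz (q + p1 + p2 - k - 1) y (- a))
       + ((-1) ^ q * inverse y * Li p1 x1 * Li p2 x2 * Li_Hurwitz q y (- a)
       + (-1) ^ (q + p2) * Li p1 x1 * Rsum (- a) [(p2, inverse x2)] q y
       + (-1) ^ (q + p1) * Li p2 x2 * Rsum (- a) [(p1, inverse x1)] q y
       + (-1) ^ (p1 + p2 + q) * Rsum (- a) [(p1, inverse x1), (p2, inverse x2)] q y)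
       + (-1) ^ q * (\<Sum>(k1, k2) \<in> {(k1, k2). k1 + k2 \<le> p1 - 1}.
           of_nat ((k2 + p2 - 1) choose (p2 - 1))
           * of_nat ((q + p1 - k1 - k2 - 2) choose (q - 1)) * D_coeff x k1
           * ((-1) ^ k2 * inverse y * Li (k2 + p2) x2 * Li_Hurwitz (p1 + q - k1 - k2 - 1) y (- a)
              + (-1) ^ p2 * Rsum (- a) [(k2 + p2, inverse x2)] (p1 + q - k1 - k2 - 1) y))
       + (-1) ^ q * (\<Sum>(k1, k2) \<in> {(k1, k2). k1 + k2 \<le> p2 - 1}.
           of_nat ((k2 + p1 - 1) choose (p1 - 1))
           * of_nat ((q + p2 - k1 - k2 - 2) choose (q - 1)) * D_coeff x k1
           * ((-1) ^ k2 * inverse y * Li (k2 + p1) x1 * Li_Hurwitz (p2 + q - k1 - k2 - 1) y (- a)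
              + (-1) ^ p1 * Rsum (- a) [(k2 + p1, inverse x1)] (p2 + q - k1 - k2 - 1) y)))"
proof -
  let ?E = "bilateral_lim_fps x1 p1" and ?G = "bilateral_lim_fps x2 p2"
  have simple: "(\<lambda>n. \<Sum>k=0..r. y ^ n * (fps_nth (bilateral_lim_fps u p n) k * fps_nth (H n) (r - k)))
     sums ((-1) ^ q * (\<Sum>k=0..r.
           of_nat ((k + p - 1) choose (p - 1)) * of_nat ((q + r - k - 1) choose (q - 1))
           * ((-1) ^ k * inverse y * Li (k + p) u * Li_Hurwitz (r + q - k) y (- a)
              + (-1) ^ p * Rsum (- a) [(k + p, inverse u)] (r + q - k) y)))"
    if "p \<ge> 1" "norm u = 1" "(p, u) \<noteq> (1, 1)" for r p u
    unfolding sum_distrib_left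
  proof (rule sums_sum, goal_cases)
    case (1 k)
    \<comment> \<open>Valid because k <= r: exponents and binomials take the form j + q with j = r -
      k, as in the coefficients of \<open>H\<close>.\<close>
    then have *: "q + r - k - 1 = r - k + q - 1" "r + q - k = r - k + q" by auto
    show ?case unfolding * by (rule sums_bilateral_H[OF that])
  qed
  have double: "(\<lambda>n. \<Sum>(k1, k2) \<in> {(k1, k2). k1 + k2 \<le> r - 1}.
        y ^ n * (D_coeff x k1 * fps_nth (bilateral_lim_fps u p n) k2 * fps_nth (H n) (r - 1 - k1 - k2)))
     sums ((-1) ^ q * (\<Sum>(k1, k2) \<in> {(k1, k2). k1 + k2 \<le> r - 1}.
           of_nat ((k2 + p - 1) choose (p - 1))
           * of_nat ((q + r - k1 - k2 - 2) choose (q - 1)) * D_coeff x k1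
           * ((-1) ^ k2 * inverse y * Li (k2 + p) u * Li_Hurwitz (r + q - k1 - k2 - 1) y (- a)
              + (-1) ^ p * Rsum (- a) [(k2 + p, inverse u)] (r + q - k1 - k2 - 1) y)))"
    if "p \<ge> 1" "norm u = 1" "(p, u) \<noteq> (1, 1)" "r \<ge> 1" for r p u
    unfolding sum_distrib_left
  proof (rule sums_sum, goal_cases)
    case (1 i)
    obtain k1 k2 where i: "i = (k1, k2)" by (cases i)
    with 1 \<open>r \<ge> 1\<close> have *: "q + r - k1 - k2 - 2 = r - 1 - k1 - k2 + q - 1" "r + q - k1 - k2 - 1 = r - 1 - k1 - k2 + q"
      by auto
    have "(\<lambda>n. D_coeff x k1 * (y ^ n * (fps_nth (bilateral_lim_fps u p n) k2 * fps_nth (H n) (r - 1 - k1 - k2)))) sums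
       (D_coeff x k1 * ((-1) ^ q * (of_nat ((k2 + p - 1) choose (p - 1)) * of_nat ((r - 1 - k1 - k2 + q - 1) choose (q - 1)) *
       ((-1) ^ k2 * inverse y * Li (k2 + p) u * Li_Hurwitz (r - 1 - k1 - k2 + q) y (- a) +
        (-1) ^ p * Rsum (- a) [(k2 + p, inverse u)] (r - 1 - k1 - k2 + q) y))))"
      by (intro sums_mult sums_bilateral_H that)
    then show ?case unfolding i prod.case * by (simp only: mult_ac)
  qed
  have kernel: "(\<lambda>n. \<Sum>k=0..p1 + p2 - 1. y ^ n * (D_coeff x k * fps_nth (H n) (p1 + p2 - 1 - k)))
     sums ((-1) ^ q * inverse y * (\<Sum>k=0..p1 + p2 - 1.
           of_nat ((q + p1 + p2 - k - 2) choose (q - 1)) * D_coeff x k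
           * Li_Hurwitz (q + p1 + p2 - k - 1) y (- a)))"
    unfolding sum_distrib_left
  proof (rule sums_sum, goal_cases)
    case (1 k)
    then have *: "q + p1 + p2 - k - 2 = p1 + p2 - 1 - k + q - 1" "q + p1 + p2 - k - 1 = p1 + p2 - 1 - k + q"
      using p1 by auto
    have "(\<lambda>n. D_coeff x k * (y ^ n * fps_nth (H n) (p1 + p2 - 1 - k))) sums
      (D_coeff x k * ((-1) ^ q * of_nat ((p1 + p2 - 1 - k + q - 1) choose (q - 1)) *
        (inverse y * Li_Hurwitz (p1 + p2 - 1 - k + q) y (- a))))"
      by (intro sums_mult sums_H)
    then show ?case unfolding * by (simp only: mult_ac)
  qed
  have top: "(\<lambda>n. y ^ n * fps_nth (H n) (p1 + p2)) sums
     ((-1) ^ q * inverse y * of_nat ((q + p1 + p2 - 1) choose (q - 1)) * Li_Hurwitz (q + p1 + p2) y (- a))"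
    using sums_H[of "p1 + p2"] by (simp add: add_ac mult_ac)
  have split: "neg_residue = (\<lambda>n. y ^ n * fps_nth (H n) (p1 + p2)
    + (\<Sum>k=0..p1. y ^ n * (fps_nth (?G n) k * fps_nth (H n) (p1 - k)))
    + (\<Sum>k=0..p2. y ^ n * (fps_nth (?E n) k * fps_nth (H n) (p2 - k)))
    + (\<Sum>k=0..p1 + p2 - 1. y ^ n * (D_coeff x k * fps_nth (H n) (p1 + p2 - 1 - k)))
    + y ^ n * (fps_nth (?E n) 0 * fps_nth (?G n) 0 * fps_nth (H n) 0)
    + (\<Sum>(k1, k2) \<in> {(k1, k2). k1 + k2 \<le> p1 - 1}. y ^ n * (D_coeff x k1 * fps_nth (?G n) k2 * fps_nth (H n) (p1 - 1 - k1 - k2)))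
    + (\<Sum>(k1, k2) \<in> {(k1, k2). k1 + k2 \<le> p2 - 1}. y ^ n * (D_coeff x k1 * fps_nth (?E n) k2 * fps_nth (H n) (p2 - 1 - k1 - k2))))"
    unfolding neg_residue_def polar_product_nth[OF p1 p2] fps_nth_Abs_fps
    unfolding distrib_left sum_distrib_left case_prod_unfold ..
  show ?thesis
    unfolding split
    by (intro sums_add top kernel sums_bilateral2_H simple double p1 p2 norm_x1 norm_x2 px1 px2)
qed

text \<open>The kernel alone is singular at n + 1, with residue \<open>inverse x ^ Suc n\<close>.
  There phi_p(s;u) takes the value \<open>inverse u ^ Suc n * (Li p u - zeta_partial n p u)\<close>,
  and the three twists multiply to \<open>inverse y ^ Suc n\<close>.\<close>

definition pos_residue :: "nat \<Rightarrow> complex" where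
  "pos_residue n = (Li p1 x1 - zeta_partial n p1 x1) * (Li p2 x2 - zeta_partial n p2 x2) *
     (inverse y ^ Suc n / (of_nat (Suc n) + a) ^ q)"

lemma sums_pos_residue:
  "pos_residue sums
     (Li p1 x1 * Li p2 x2 * Li_Hurwitz q (inverse y) (a + 1)
       - inverse y * Li p1 x1 * Rsum (a + 1) [(p2, x2)] q (inverse y)
       - inverse y * Li p2 x2 * Rsum (a + 1) [(p1, x1)] q (inverse y)
       + inverse y * Rsum (a + 1) [(p1, x1), (p2, x2)] q (inverse y))"
proof -
  have qy': "(q, inverse y) \<noteq> (1, 1)" using qy by auto
  have nz: "of_nat (Suc n) + a \<noteq> 0" "of_nat n + (a + 1) \<noteq> 0" for n
    using add_a_nonzero(1)[of "Suc n"] by (simp_all add: add_ac)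
  note z1 = slow_zeta_partial[OF p1 norm_x1 px1] and z2 = slow_zeta_partial[OF p2 norm_x2 px2]
  have 0: "(\<lambda>n. inverse y ^ Suc n / (of_nat (Suc n) + a) ^ q) sums Li_Hurwitz q (inverse y) (a + 1)"
    using sums_Li_Hurwitz(1)[OF norm_inverses(4) q qy', of "a + 1"] nz by (simp add: add_ac)
  have 1: "(\<lambda>n. zeta_partial n p1 x1 * inverse y ^ Suc n / (of_nat (Suc n) + a) ^ q) sums
      (inverse y * Rsum (a + 1) [(p1, x1)] q (inverse y))"
    using slow_series_shift'[OF z1 _ norm_inverses(4) q qy' nz(1)] by (simp add: Rsum_def)
  have 2: "(\<lambda>n. zeta_partial n p2 x2 * inverse y ^ Suc n / (of_nat (Suc n) + a) ^ q) sums
      (inverse y * Rsum (a + 1) [(p2, x2)] q (inverse y))"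
    using slow_series_shift'[OF z2 _ norm_inverses(4) q qy' nz(1)] by (simp add: Rsum_def)
  have 3: "(\<lambda>n. zeta_partial n p1 x1 * zeta_partial n p2 x2 * inverse y ^ Suc n / (of_nat (Suc n) + a) ^ q) sums
      (inverse y * Rsum (a + 1) [(p1, x1), (p2, x2)] q (inverse y))"
    using slow_series_shift'[OF slow_mult[OF z1 z2] _ norm_inverses(4) q qy' nz(1)] by (simp add: Rsum_def)
  have "(\<lambda>n. Li p1 x1 * Li p2 x2 * (inverse y ^ Suc n / (of_nat (Suc n) + a) ^ q)
      - Li p1 x1 * (zeta_partial n p2 x2 * inverse y ^ Suc n / (of_nat (Suc n) + a) ^ q)
      - Li p2 x2 * (zeta_partial n p1 x1 * inverse y ^ Suc n / (of_nat (Suc n) + a) ^ q)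
      + zeta_partial n p1 x1 * zeta_partial n p2 x2 * inverse y ^ Suc n / (of_nat (Suc n) + a) ^ q)
    sums (Li p1 x1 * Li p2 x2 * Li_Hurwitz q (inverse y) (a + 1)
      - Li p1 x1 * (inverse y * Rsum (a + 1) [(p2, x2)] q (inverse y))
      - Li p2 x2 * (inverse y * Rsum (a + 1) [(p1, x1)] q (inverse y))
      + inverse y * Rsum (a + 1) [(p1, x1), (p2, x2)] q (inverse y))"
    by (intro sums_add sums_diff sums_mult 0 1 2 3)
  moreover have "pos_residue = (\<lambda>n. Li p1 x1 * Li p2 x2 * (inverse y ^ Suc n / (of_nat (Suc n) + a) ^ q)
      - Li p1 x1 * (zeta_partial n p2 x2 * inverse y ^ Suc n / (of_nat (Suc n) + a) ^ q)
      - Li p2 x2 * (zeta_partial n p1 x1 * inverse y ^ Suc n / (of_nat (Suc n) + a) ^ q)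
      + zeta_partial n p1 x1 * zeta_partial n p2 x2 * inverse y ^ Suc n / (of_nat (Suc n) + a) ^ q)"
    unfolding pos_residue_def times_divide_eq_right[symmetric] mult.assoc
    by (simp add: algebra_simps del: power_Suc of_nat_Suc times_divide_eq_right)
  ultimately show ?thesis by (simp only: mult_ac)
qed

end

section \<open>The truncated residue identity\<close>

lemma sum_lessThan_add: "(\<Sum>j<n + m. f j) = (\<Sum>j<n. f j) + (\<Sum>j<m. f (n + j))"
  for f :: "nat \<Rightarrow> 'a :: comm_monoid_add"
  by (induction m) (auto simp: add_ac)

definition lerch_partial :: "nat \<Rightarrow> complex \<Rightarrow> nat \<Rightarrow> complex \<Rightarrow> complex" where
  "lerch_partial N u p z = (\<Sum>k\<le>N. u ^ k / (of_nat k + z) ^ p)"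

definition lerch_partial_fps :: "nat \<Rightarrow> complex \<Rightarrow> nat \<Rightarrow> complex \<Rightarrow> complex fps" where
  "lerch_partial_fps N u p c = (\<Sum>k\<le>N. fps_const (u ^ k) * fps_recip_power (of_nat k + c) p)"

lemma has_fps_expansion_const_recip:
  assumes "c \<noteq> 0" "m \<ge> 1"
  shows "(\<lambda>t. b / (c + t) ^ m) has_fps_expansion fps_const b * fps_recip_power c m"
  using has_fps_expansion_cmult_left[OF has_fps_expansion_recip_power[OF assms], of b] by simp

lemma has_fps_expansion_lerch_partial:
  assumes "\<And>k. of_nat k + c \<noteq> 0" "p \<ge> 1"
  shows "(\<lambda>t. lerch_partial N u p (c + t)) has_fps_expansion lerch_partial_fps N u p c"
  unfolding lerch_partial_def lerch_partial_fps_def add.assoc[symmetric]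
  by (intro fps_expansion_intros has_fps_expansion_const_recip assms)

text \<open>Splitting at k = n isolates the polar term; once \<open>u ^ n\<close> is extracted, the
  two remaining sums depend on n only through their lengths.\<close>

lemma lerch_partial_near_pole:
  assumes "n \<le> N" "u \<noteq> 0"
  shows "lerch_partial N u p (- of_nat n + t) = u ^ n * (1 / t ^ p +
     ((\<Sum>j<N - n. u ^ Suc j / (of_nat (Suc j) + t) ^ p) +
      (\<Sum>j<n. inverse u ^ Suc j / (- of_nat (Suc j) + t) ^ p)))"
proof -
  let ?f = "\<lambda>k. u ^ k / (of_nat k + (- of_nat n + t)) ^ p"
  have "lerch_partial N u p (- of_nat n + t) = (\<Sum>k<n + Suc (N - n). ?f k)"
    using assms by (simp add: lerch_partial_def lessThan_Suc_atMost)
  also have "\<dots> = (\<Sum>k<n. ?f k) + (\<Sum>j<Suc (N - n). ?f (n + j))"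
    by (rule sum_lessThan_add)
  also have "(\<Sum>j<Suc (N - n). ?f (n + j)) = u ^ n / t ^ p + (\<Sum>j<N - n. ?f (n + Suc j))"
    by (subst sum.lessThan_Suc_shift) simp
  also have "(\<Sum>j<N - n. ?f (n + Suc j)) = u ^ n * (\<Sum>j<N - n. u ^ Suc j / (of_nat (Suc j) + t) ^ p)"
    by (simp add: sum_distrib_left power_add mult_ac add_ac)
  also have "(\<Sum>k<n. ?f k) = u ^ n * (\<Sum>j<n. inverse u ^ Suc j / (- of_nat (Suc j) + t) ^ p)"
    unfolding sum_distrib_left
  proof (rule sum.reindex_bij_witness[of _ "\<lambda>j. n - Suc j" "\<lambda>k. n - Suc k"], goal_cases)
    case (5 k)
    then obtain j where n: "n = k + Suc j" by (metis less_imp_Suc_add lessThan_iff add_Suc_right)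
    have "u ^ n * inverse u ^ Suc j = u ^ k"
      using assms(2) by (simp add: n power_add power_inverse field_simps)
    then show ?case by (simp add: n flip: times_divide_eq_right) (simp add: algebra_simps)
  qed auto
  finally show ?thesis by (simp add: algebra_simps)
qed

lemma has_fps_expansion_bilateral:
  assumes "p \<ge> 1"
  shows "(\<lambda>t. (\<Sum>j<M. u ^ Suc j / (of_nat (Suc j) + t) ^ p) +
      (\<Sum>j<K. inverse u ^ Suc j / (- of_nat (Suc j) + t) ^ p)) has_fps_expansion bilateral_fps u p M K"
proof -
  have "(\<lambda>t. (\<Sum>j<M. u ^ Suc j / (of_nat (Suc j) + t) ^ p) +
      (\<Sum>j<K. inverse u ^ Suc j / (- of_nat (Suc j) + t) ^ p)) has_fps_expansion
    ((\<Sum>j<M. fps_const (u ^ Suc j) * fps_recip_power (of_nat (Suc j)) p) +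
     (\<Sum>j<K. fps_const (inverse u ^ Suc j) * fps_recip_power (- of_nat (Suc j)) p))"
    by (intro fps_expansion_intros has_fps_expansion_const_recip assms)
       (auto simp del: of_nat_Suc)
  also have "\<dots> = bilateral_fps u p M K"
  proof (rule fps_ext)
    fix k
    have pos: "u ^ Suc j * fps_nth (fps_recip_power (of_nat (Suc j)) p) k =
        of_nat ((k + p - 1) choose (p - 1)) * ((-1) ^ k * (u ^ Suc j / of_nat (Suc j) ^ (k + p)))" for j
      by (simp add: fps_recip_power_def del: of_nat_Suc power_Suc)
    have neg: "inverse u ^ Suc j * fps_nth (fps_recip_power (- of_nat (Suc j)) p) k =
        of_nat ((k + p - 1) choose (p - 1)) * ((-1) ^ p * (inverse u ^ Suc j / of_nat (Suc j) ^ (k + p)))" for j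
      by (subst fps_recip_power_uminus_nth) (simp_all del: of_nat_Suc power_Suc)
    show "fps_nth ((\<Sum>j<M. fps_const (u ^ Suc j) * fps_recip_power (of_nat (Suc j)) p) +
     (\<Sum>j<K. fps_const (inverse u ^ Suc j) * fps_recip_power (- of_nat (Suc j)) p)) k =
      fps_nth (bilateral_fps u p M K) k"
      unfolding fps_add_nth fps_sum_nth fps_mult_left_const_nth pos neg
      unfolding sum_distrib_left[symmetric] bilateral_fps_def zeta_partial_eq fps_nth_Abs_fps distrib_left ..
  qed
  finally show ?thesis .
qed

lemma lerch_partial_Suc:
  assumes "u \<noteq> 0"
  shows "lerch_partial N u p (of_nat (Suc m)) =
    inverse u ^ Suc m * (zeta_partial (N + 1 + m) p u - zeta_partial m p u)"
proof -
  have "zeta_partial (m + Suc N) p u - zeta_partial m p u =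
      (\<Sum>k\<le>N. u ^ Suc (m + k) / of_nat (Suc (m + k)) ^ p)"
    unfolding zeta_partial_eq sum_lessThan_add lessThan_Suc_atMost by simp
  also have "\<dots> = u ^ Suc m * lerch_partial N u p (of_nat (Suc m))"
    unfolding lerch_partial_def sum_distrib_left by (simp add: power_add add_ac mult_ac)
  finally show ?thesis using assms by (simp add: add_ac power_inverse field_simps del: power_Suc of_nat_Suc)
qed

section \<open>Partial fractions at infinity\<close>

lemma tendsto_recip_shift_at_infinity: "((\<lambda>z::complex. 1 / (c + z)) \<longlongrightarrow> 0) at_infinity"
proof -
  have "filterlim (\<lambda>z. c + z) at_infinity at_infinity"
    by (rule tendsto_add_filterlim_at_infinity[OF tendsto_const filterlim_ident])
  then have "((\<lambda>z. inverse (c + z)) \<longlongrightarrow> 0) at_infinity"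
    by (rule filterlim_compose[OF tendsto_inverse_0])
  then show ?thesis by (simp add: field_simps)
qed

lemma tendsto_const_recip_power_at_infinity:
  assumes "m \<ge> 1"
  shows "((\<lambda>z::complex. b / (c + z) ^ m) \<longlongrightarrow> 0) at_infinity"
proof -
  have "((\<lambda>z::complex. b * (1 / (c + z)) ^ m) \<longlongrightarrow> b * 0 ^ m) at_infinity"
    by (intro tendsto_intros tendsto_recip_shift_at_infinity)
  then show ?thesis using assms by (simp add: power_divide zero_power)
qed

lemma tendsto_mult_recip_at_infinity: "((\<lambda>z::complex. z * (b / (c + z))) \<longlongrightarrow> b) at_infinity"
proof -
  have "((\<lambda>z. b - c * b * (1 / (c + z))) \<longlongrightarrow> b - c * b * 0) at_infinity"
    by (intro tendsto_intros tendsto_recip_shift_at_infinity)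
  moreover have "eventually (\<lambda>z::complex. z \<noteq> - c) at_infinity"
    unfolding eventually_at_infinity by (rule exI[of _ "norm c + 1"]) auto
  then have "eventually (\<lambda>z. b - c * b * (1 / (c + z)) = z * (b / (c + z))) at_infinity"
    by eventually_elim (auto simp: field_simps eq_neg_iff_add_eq_0 add.commute)
  ultimately show ?thesis by (simp add: Lim_transform_eventually)
qed

context twisted_kernel
begin

text \<open>The truncation $-N-1\le k\le N$ is asymmetric so that the positive poles are \<open>Suc m\<close> with
  \<open>m \<le> N\<close> and every residue sum runs over \<open>{..N}\<close>.\<close>

definition bilateral_partial :: "nat \<Rightarrow> complex \<Rightarrow> complex" where
  "bilateral_partial N z = lerch_partial N x 1 z + (\<Sum>m\<le>N. inverse x ^ Suc m / (z - of_nat (Suc m)))"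

definition integrand :: "nat \<Rightarrow> complex \<Rightarrow> complex" where
  "integrand N z = bilateral_partial N z * lerch_partial N x1 p1 z * lerch_partial N x2 p2 z / (a + z) ^ q"

definition poles :: "nat \<Rightarrow> complex set" where
  "poles N = insert (- a) ((\<lambda>n. - of_nat n) ` {..N} \<union> (\<lambda>m. of_nat (Suc m)) ` {..N})"

lemma integrand_holomorphic: "integrand N holomorphic_on (UNIV - poles N)"
proof -
  have 1: "of_nat k + z \<noteq> 0" if "z \<notin> poles N" "k \<le> N" for k z
    using that by (auto simp: poles_def image_iff add_eq_0_iff)
  have 2: "z - of_nat (Suc k) \<noteq> 0" if "z \<notin> poles N" "k \<le> N" for k z
    using that by (auto simp: poles_def image_iff simp del: of_nat_Suc)
  have 3: "a + z \<noteq> 0" if "z \<notin> poles N" for z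
    using that by (auto simp: poles_def add_eq_0_iff)
  show ?thesis
    unfolding integrand_def bilateral_partial_def lerch_partial_def
    by (intro holomorphic_intros) (use 1 2 3 in auto)
qed

text \<open>The factor \<open>z\<close> is absorbed by the kernel, a finite sum of simple fractions,
  so that \<open>z\<close> times the kernel has a finite limit; the other three factors tend to 0
  because \<open>p1\<close>, \<open>p2\<close> and \<open>q\<close> are positive.\<close>

lemma integrand_decay: "((\<lambda>z. z * integrand N z) \<longlongrightarrow> 0) at_infinity"
proof -
  have B: "((\<lambda>z. lerch_partial N u p z) \<longlongrightarrow> 0) at_infinity" if "p \<ge> 1" for u p
    unfolding lerch_partial_def by (rule tendsto_null_sum) (rule tendsto_const_recip_power_at_infinity[OF that])
  have "((\<lambda>z. (\<Sum>k\<le>N. z * (x ^ k / (of_nat k + z))) + (\<Sum>m\<le>N. z * (inverse x ^ Suc m / (- of_nat (Suc m) + z))))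
      \<longlongrightarrow> (\<Sum>k\<le>N. x ^ k) + (\<Sum>m\<le>N. inverse x ^ Suc m)) at_infinity"
    by (intro tendsto_intros tendsto_mult_recip_at_infinity)
  then have "((\<lambda>z. ((\<Sum>k\<le>N. z * (x ^ k / (of_nat k + z))) + (\<Sum>m\<le>N. z * (inverse x ^ Suc m / (- of_nat (Suc m) + z))))
      * lerch_partial N x1 p1 z * lerch_partial N x2 p2 z * (1 / (a + z) ^ q)) \<longlongrightarrow>
     ((\<Sum>k\<le>N. x ^ k) + (\<Sum>m\<le>N. inverse x ^ Suc m)) * 0 * 0 * 0) at_infinity"
    by (intro tendsto_mult B p1 p2 tendsto_const_recip_power_at_infinity q)
  moreover have "z * integrand N z = ((\<Sum>k\<le>N. z * (x ^ k / (of_nat k + z))) + (\<Sum>m\<le>N. z * (inverse x ^ Suc m / (- of_nat (Suc m) + z))))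
      * lerch_partial N x1 p1 z * lerch_partial N x2 p2 z * (1 / (a + z) ^ q)" for z
  proof -
    have "(\<Sum>k\<le>N. z * (x ^ k / (of_nat k + z))) + (\<Sum>m\<le>N. z * (inverse x ^ Suc m / (- of_nat (Suc m) + z))) = z * bilateral_partial N z"
      by (simp only: bilateral_partial_def lerch_partial_def distrib_left sum_distrib_left power_one_right uminus_add_conv_diff)
    then show ?thesis by (simp add: integrand_def mult_ac)
  qed
  ultimately show ?thesis by (simp only: mult_zero_right)
qed

lemma sum_residues_integrand:
  "residue (integrand N) (- a) + (\<Sum>n\<le>N. residue (integrand N) (- of_nat n)) +
     (\<Sum>m\<le>N. residue (integrand N) (of_nat (Suc m))) = 0"
proof -
  have "- a \<noteq> of_int k" for k
    using of_int_add_a_nonzero[of k] by (metis add.commute add_eq_0_iff2 add.inverse_inverse)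
  then have notin: "- a \<notin> (\<lambda>n. - of_nat n) ` {..N} \<union> (\<lambda>m. of_nat (Suc m)) ` {..N}"
    by (auto simp del: of_nat_Suc) (metis of_int_minus of_int_of_nat_eq add.inverse_inverse)+
  have "- of_nat n \<noteq> (of_nat (Suc m) :: complex)" for n m
    by (metis add_eq_0_iff of_nat_add of_nat_eq_0_iff add_is_0 nat.distinct(1))
  then have disj: "(\<lambda>n. - of_nat n :: complex) ` {..N} \<inter> (\<lambda>m. of_nat (Suc m)) ` {..N} = {}"
    by blast
  have "(\<Sum>p\<in>poles N. residue (integrand N) p) = 0"
    by (intro sum_residues_eq_0 integrand_holomorphic integrand_decay) (simp add: poles_def)
  also have "(\<Sum>p\<in>poles N. residue (integrand N) p) = residue (integrand N) (- a) +
      ((\<Sum>p\<in>(\<lambda>n. - of_nat n) ` {..N}. residue (integrand N) p) +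
       (\<Sum>p\<in>(\<lambda>m. of_nat (Suc m)) ` {..N}. residue (integrand N) p))"
    unfolding poles_def using notin disj by (simp add: sum.union_disjoint)
  also have "(\<Sum>p\<in>(\<lambda>n. - of_nat n) ` {..N}. residue (integrand N) p) = (\<Sum>n\<le>N. residue (integrand N) (- of_nat n))"
    by (subst sum.reindex) (auto simp: inj_on_def)
  also have "(\<Sum>p\<in>(\<lambda>m. of_nat (Suc m)) ` {..N}. residue (integrand N) p) = (\<Sum>m\<le>N. residue (integrand N) (of_nat (Suc m)))"
    by (subst sum.reindex) (auto simp: inj_on_def)
  finally show ?thesis by (simp add: add_ac)
qed

text \<open>Each singular factor has the form \<open>u ^ n * (1 + t ^ p * V) / t ^ p\<close>, with p
  = 1 for the kernel. Hence the pole has order p1 + p2 + 1 and the twists multiply to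
  \<open>y ^ n\<close>.\<close>

lemma residue_at_nonpos:
  assumes "n \<le> N"
  shows "residue (integrand N) (- of_nat n) = y ^ n * fps_nth ((1 + fps_X * bilateral_fps x 1 (N - n) (N + 1 + n)) *
     (1 + fps_X ^ p1 * bilateral_fps x1 p1 (N - n) n) * (1 + fps_X ^ p2 * bilateral_fps x2 p2 (N - n) n) * H n) (p1 + p2)"
proof -
  define V where "V = (\<lambda>u p M K t. (\<Sum>j<M. u ^ Suc j / (of_nat (Suc j) + t) ^ p) +
      (\<Sum>j<K. inverse u ^ Suc j / (- of_nat (Suc j) + t) ^ p) :: complex)"
  have V: "V u p M K has_fps_expansion bilateral_fps u p M K" if "p \<ge> 1" for u p M K
    unfolding V_def by (rule has_fps_expansion_bilateral[OF that])
  have lerch: "lerch_partial N u p (- of_nat n + t) = u ^ n * (1 / t ^ p + V u p (N - n) n t)"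
    if "u \<noteq> 0" for u p t
    unfolding V_def by (rule lerch_partial_near_pole[OF assms that])
  have bilateral_partial: "bilateral_partial N (- of_nat n + t) = x ^ n * (1 / t + V x 1 (N - n) (N + 1 + n) t)" for t
  proof -
    \<comment> \<open>Seen from the pole -n, the negative-index summands of the kernel prolong its
      left half from distance n + 1 to n + N + 1, whence the length N + 1 + n.\<close>
    have "(\<Sum>m\<le>N. inverse x ^ Suc m / (- of_nat n + t - of_nat (Suc m))) =
        x ^ n * (\<Sum>m<N + 1. inverse x ^ Suc (n + m) / (- of_nat (Suc (n + m)) + t))"
    proof -
      have xi: "x ^ n * inverse x ^ Suc (n + m) = inverse x ^ Suc m" for m
        using nonzero(1) by (simp add: power_add power_inverse)
      show ?thesis
        unfolding sum_distrib_left times_divide_eq_right xi Suc_eq_plus1[symmetric] lessThan_Suc_atMost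
        by (simp add: algebra_simps del: sum.atMost_Suc power_Suc)
    qed
    moreover have "V x 1 (N - n) (N + 1 + n) t = V x 1 (N - n) n t +
        (\<Sum>m<N + 1. inverse x ^ Suc (n + m) / (- of_nat (Suc (n + m)) + t))"
      unfolding V_def add.commute[of "N + 1" n] sum_lessThan_add by simp
    ultimately show ?thesis
      unfolding bilateral_partial_def lerch[OF nonzero(1)] by (simp add: distrib_left add.assoc)
  qed
  define g where "g = (\<lambda>t. y ^ n * ((1 + t * V x 1 (N - n) (N + 1 + n) t) * (1 + t ^ p1 * V x1 p1 (N - n) n t) *
      (1 + t ^ p2 * V x2 p2 (N - n) n t) * (1 / ((a - of_nat n) + t) ^ q)))"
  have "g has_fps_expansion fps_const (y ^ n) * ((1 + fps_X * bilateral_fps x 1 (N - n) (N + 1 + n)) *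
     (1 + fps_X ^ p1 * bilateral_fps x1 p1 (N - n) n) * (1 + fps_X ^ p2 * bilateral_fps x2 p2 (N - n) n) * H n)"
    unfolding g_def H_def
    by (intro fps_expansion_intros V p1 p2 has_fps_expansion_recip_power add_a_nonzero q) simp
  moreover have "integrand N (- of_nat n + t) = g t / t ^ Suc (p1 + p2)" if "t \<noteq> 0" for t
  proof -
    have split: "1 / t ^ p + v = (1 + t ^ p * v) / t ^ p" for p v
      using that by (simp add: field_simps)
    have K: "bilateral_partial N (- of_nat n + t) = x ^ n * ((1 + t * V x 1 (N - n) (N + 1 + n) t) / t)"
      unfolding bilateral_partial using split[of 1] by simp
    have D: "a + (- of_nat n + t) = (a - of_nat n) + t" by simp
    show ?thesis
      unfolding integrand_def K D lerch[OF nonzero(2)] lerch[OF nonzero(3)] split g_def y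
      by (simp add: power_mult_distrib power_add mult_ac)
  qed
  then have "eventually (\<lambda>t. integrand N (- of_nat n + t) = g t / t ^ Suc (p1 + p2)) (at 0)"
    by (auto simp: eventually_at_filter)
  ultimately have "residue (integrand N) (- of_nat n) = fps_nth (fps_const (y ^ n) * ((1 + fps_X * bilateral_fps x 1 (N - n) (N + 1 + n)) *
     (1 + fps_X ^ p1 * bilateral_fps x1 p1 (N - n) n) * (1 + fps_X ^ p2 * bilateral_fps x2 p2 (N - n) n) * H n)) (p1 + p2)"
    by (rule residue_eq_fps_nth)
  then show ?thesis by (simp only: fps_mult_left_const_nth)
qed

lemma residue_at_pos:
  assumes "m \<le> N"
  shows "residue (integrand N) (of_nat (Suc m)) =
    (zeta_partial (N + 1 + m) p1 x1 - zeta_partial m p1 x1) * (zeta_partial (N + 1 + m) p2 x2 - zeta_partial m p2 x2) *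
     (inverse y ^ Suc m / (of_nat (Suc m) + a) ^ q)"
proof -
  let ?c = "of_nat (Suc m) :: complex"
  \<comment> \<open>The part of the kernel that is regular at the pole: the summand
    \<open>m' = m\<close> is left out. The exponent 1 keeps the summands in the shape of
    \<open>has_fps_expansion_const_recip\<close>.\<close>
  define R where "R = (\<lambda>t. lerch_partial N x 1 (?c + t) +
      (\<Sum>m'\<in>{..N} - {m}. inverse x ^ Suc m' / ((?c - of_nat (Suc m')) + t) ^ 1))"
  define S where "S = lerch_partial_fps N x 1 ?c +
      (\<Sum>m'\<in>{..N} - {m}. fps_const (inverse x ^ Suc m') * fps_recip_power (?c - of_nat (Suc m')) 1)"
  have nz: "of_nat k + ?c \<noteq> 0" for k
    by (metis of_nat_add of_nat_eq_0_iff add_is_0 nat.distinct(1))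
  have "R has_fps_expansion S"
    unfolding R_def S_def
    by (intro fps_expansion_intros has_fps_expansion_lerch_partial has_fps_expansion_const_recip nz) auto
  moreover define g where "g = (\<lambda>t. (inverse x ^ Suc m + t * R t) * lerch_partial N x1 p1 (?c + t) * lerch_partial N x2 p2 (?c + t) *
      (1 / ((a + ?c) + t) ^ q))"
  have anz: "a + ?c \<noteq> 0" using add_a_nonzero(1)[of "Suc m"] by (simp add: add.commute)
  ultimately have "g has_fps_expansion (fps_const (inverse x ^ Suc m) + fps_X * S) * lerch_partial_fps N x1 p1 ?c *
      lerch_partial_fps N x2 p2 ?c * fps_recip_power (a + ?c) q"
    unfolding g_def
    by (intro fps_expansion_intros has_fps_expansion_lerch_partial nz p1 p2 has_fps_expansion_recip_power anz q)
  moreover have "integrand N (?c + t) = g t / t ^ Suc 0" if "t \<noteq> 0" for t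
  proof -
    have "(\<Sum>m'\<le>N. inverse x ^ Suc m' / (?c + t - of_nat (Suc m'))) =
        inverse x ^ Suc m / t + (\<Sum>m'\<in>{..N} - {m}. inverse x ^ Suc m' / ((?c - of_nat (Suc m')) + t) ^ 1)"
      using assms by (subst sum.remove[of _ m]) (auto simp: algebra_simps)
    then have "bilateral_partial N (?c + t) = (inverse x ^ Suc m + t * R t) / t"
      unfolding bilateral_partial_def R_def using that by (simp add: field_simps del: of_nat_Suc power_Suc)
    then show ?thesis
      unfolding integrand_def g_def by (simp add: add.assoc del: of_nat_Suc power_Suc)
  qed
  then have "eventually (\<lambda>t. integrand N (?c + t) = g t / t ^ Suc 0) (at 0)"
    by (auto simp: eventually_at_filter)
  ultimately have "residue (integrand N) ?c = fps_nth ((fps_const (inverse x ^ Suc m) + fps_X * S) * lerch_partial_fps N x1 p1 ?c *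
      lerch_partial_fps N x2 p2 ?c * fps_recip_power (a + ?c) q) 0"
    by (rule residue_eq_fps_nth)
  also have "\<dots> = g 0"
    by (rule has_fps_expansion_imp_0_eq_fps_nth_0[symmetric]) fact
  also have "\<dots> = (zeta_partial (N + 1 + m) p1 x1 - zeta_partial m p1 x1) * (zeta_partial (N + 1 + m) p2 x2 - zeta_partial m p2 x2) *
     (inverse y ^ Suc m / (of_nat (Suc m) + a) ^ q)"
    unfolding g_def y add_0_right lerch_partial_Suc[OF nonzero(2)] lerch_partial_Suc[OF nonzero(3)]
    by (simp add: power_mult_distrib add.commute[of a] del: of_nat_Suc power_Suc)
  finally show ?thesis .
qed

text \<open>Only \<open>1 / (a + z) ^ q\<close> is singular at \<open>- a\<close>, so the residue is
  the coefficient q - 1 of a product of three regular series; hence the sum over triples.\<close>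

lemma residue_at_minus_a:
  "residue (integrand N) (- a) =
    (\<Sum>(k1, k2, k3) \<in> {(k1, k2, k3). k1 + k2 + k3 = q - 1}.
       fps_nth (lerch_partial_fps N x 1 (- a) + (\<Sum>m\<le>N. fps_const (inverse x ^ Suc m) * fps_recip_power (- (of_nat (Suc m) + a)) 1)) k1 *
       fps_nth (lerch_partial_fps N x1 p1 (- a)) k2 * fps_nth (lerch_partial_fps N x2 p2 (- a)) k3)"
proof -
  let ?S = "lerch_partial_fps N x 1 (- a) + (\<Sum>m\<le>N. fps_const (inverse x ^ Suc m) * fps_recip_power (- (of_nat (Suc m) + a)) 1)"
  have nz: "- (of_nat (Suc m) + a) \<noteq> 0" for m
    using add_a_nonzero(1)[of "Suc m"] by (simp only: neg_equal_0_iff_equal not_False_eq_True)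
  have "(\<lambda>t. lerch_partial N x 1 (- a + t) + (\<Sum>m\<le>N. inverse x ^ Suc m / (- (of_nat (Suc m) + a) + t) ^ 1)) has_fps_expansion ?S"
    by (intro fps_expansion_intros has_fps_expansion_lerch_partial has_fps_expansion_const_recip add_a_nonzero nz) simp_all
  then have "(\<lambda>t. bilateral_partial N (- a + t)) has_fps_expansion ?S"
    by (simp add: bilateral_partial_def algebra_simps)
  then have "(\<lambda>t. bilateral_partial N (- a + t) * lerch_partial N x1 p1 (- a + t) * lerch_partial N x2 p2 (- a + t)) has_fps_expansion
      ?S * lerch_partial_fps N x1 p1 (- a) * lerch_partial_fps N x2 p2 (- a)"
    by (intro fps_expansion_intros has_fps_expansion_lerch_partial p1 p2 add_a_nonzero)
  moreover have "eventually (\<lambda>t. integrand N (- a + t) =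
      bilateral_partial N (- a + t) * lerch_partial N x1 p1 (- a + t) * lerch_partial N x2 p2 (- a + t) / t ^ Suc (q - 1)) (at 0)"
    using q by (simp add: integrand_def)
  ultimately have "residue (integrand N) (- a) = fps_nth (?S * lerch_partial_fps N x1 p1 (- a) * lerch_partial_fps N x2 p2 (- a)) (q - 1)"
    by (rule residue_eq_fps_nth)
  then show ?thesis by (simp only: fps_mult3_nth')
qed

section \<open>Limits of the three kinds of residues as the truncation is removed\<close>

lemma lerch_partial_fps_tendsto:
  assumes "p \<ge> 1" "norm u = 1" "(p, u) \<noteq> (1, 1)"
  shows "(\<lambda>N. fps_nth (lerch_partial_fps N u p (- a)) k) \<longlonglongrightarrow>
    (-1) ^ k * of_nat ((k + p - 1) choose (p - 1)) * (inverse u * Li_Hurwitz (k + p) u (- a))"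
proof -
  have "(\<lambda>n. u ^ n / (of_nat n + - a) ^ (k + p)) sums (inverse u * Li_Hurwitz (k + p) u (- a))"
    by (rule sums_Li_Hurwitz(2)) (use assms exponent_side_condition[OF assms(1,3)] add_a_nonzero in auto)
  then have "(\<lambda>n. (-1) ^ k * of_nat ((k + p - 1) choose (p - 1)) * (u ^ n / (of_nat n + - a) ^ (k + p))) sums
     ((-1) ^ k * of_nat ((k + p - 1) choose (p - 1)) * (inverse u * Li_Hurwitz (k + p) u (- a)))"
    by (rule sums_mult)
  then show ?thesis
    unfolding sums_def_le lerch_partial_fps_def fps_sum_nth fps_mult_left_const_nth fps_recip_power_def fps_nth_Abs_fps
    by (simp add: mult_ac)
qed

text \<open>Directly, the two halves tend to polylogarithms with parameters \<open>- a\<close> and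
  \<open>a + 1\<close>. Moving the term of index 0 from the first half to the second gives the
  parameters \<open>1 - a\<close> and \<open>a\<close>; the boundary terms cancel because
  \<open>(-1) ^ k / (- a) ^ (k + 1) = - 1 / a ^ (k + 1)\<close>.\<close>

lemma kernel_fps_tendsto:
  "(\<lambda>N. fps_nth (lerch_partial_fps N x 1 (- a) + (\<Sum>m\<le>N. fps_const (inverse x ^ Suc m) * fps_recip_power (- (of_nat (Suc m) + a)) 1)) k)
    \<longlonglongrightarrow> (-1) ^ k * Li_Hurwitz (k + 1) x (1 - a) - x * Li_Hurwitz (k + 1) (inverse x) a"
proof -
  have x': "(k + 1, inverse x) \<noteq> (1, 1)" using x_neq_1 by auto
  have nz: "of_nat n + (a + 1) \<noteq> 0" for n using add_a_nonzero(1)[of "Suc n"] by (simp add: add_ac)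
  have a0: "a \<noteq> 0" using a by auto
  have 1: "(\<lambda>N. fps_nth (lerch_partial_fps N x 1 (- a)) k) \<longlonglongrightarrow> (-1) ^ k * (inverse x * Li_Hurwitz (k + 1) x (- a))"
    using lerch_partial_fps_tendsto[of 1 x k] norm_x x_neq_1 by simp
  have "(\<lambda>n. inverse x ^ Suc n / (of_nat n + (a + 1)) ^ (k + 1)) sums Li_Hurwitz (k + 1) (inverse x) (a + 1)"
    by (intro sums_Li_Hurwitz norm_inverses x' nz) simp
  then have "(\<lambda>N. - (\<Sum>n\<le>N. inverse x ^ Suc n / (of_nat (Suc n) + a) ^ (k + 1))) \<longlonglongrightarrow> - Li_Hurwitz (k + 1) (inverse x) (a + 1)"
    unfolding sums_def_le by (intro tendsto_minus) (simp add: add_ac)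
  moreover have "fps_nth (\<Sum>m\<le>N. fps_const (inverse x ^ Suc m) * fps_recip_power (- (of_nat (Suc m) + a)) 1) k =
      - (\<Sum>n\<le>N. inverse x ^ Suc n / (of_nat (Suc n) + a) ^ (k + 1))" for N
    unfolding fps_sum_nth fps_mult_left_const_nth sum_negf[symmetric]
    by (intro sum.cong refl, subst fps_recip_power_uminus_nth) (use add_a_nonzero in \<open>auto simp del: of_nat_Suc\<close>)
  ultimately have 2: "(\<lambda>N. fps_nth (\<Sum>m\<le>N. fps_const (inverse x ^ Suc m) * fps_recip_power (- (of_nat (Suc m) + a)) 1) k) \<longlonglongrightarrow>
      - Li_Hurwitz (k + 1) (inverse x) (a + 1)"
    by simp
  have s1: "Li_Hurwitz (k + 1) x (- a) = x / (- a) ^ (k + 1) + x * Li_Hurwitz (k + 1) x (- a + 1)"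
    by (rule Li_Hurwitz_shift) (use norm_x x_neq_1 add_a_nonzero in auto)
  have s2: "Li_Hurwitz (k + 1) (inverse x) a = inverse x / a ^ (k + 1) + inverse x * Li_Hurwitz (k + 1) (inverse x) (a + 1)"
    by (rule Li_Hurwitz_shift) (use norm_inverses x' add_a_nonzero in auto)
  have e1: "inverse x * Li_Hurwitz (k + 1) x (- a) = 1 / (- a) ^ (k + 1) + Li_Hurwitz (k + 1) x (1 - a)"
    unfolding s1 using nonzero(1) by (simp add: distrib_left right_diff_distrib)
  have e2: "x * Li_Hurwitz (k + 1) (inverse x) a = 1 / a ^ (k + 1) + Li_Hurwitz (k + 1) (inverse x) (a + 1)"
    unfolding s2 using nonzero(1) by (simp add: distrib_left)
  have "(-1) ^ k * (1 / (- a) ^ (k + 1)) = - (1 / a ^ (k + 1))"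
    using a0 by (simp add: power_minus[of a] field_simps)
  then have "(-1) ^ k * (inverse x * Li_Hurwitz (k + 1) x (- a)) + - Li_Hurwitz (k + 1) (inverse x) (a + 1) =
    (-1) ^ k * Li_Hurwitz (k + 1) x (1 - a) - x * Li_Hurwitz (k + 1) (inverse x) a"
    by (simp only: e1 e2 distrib_left) simp
  with tendsto_add[OF 1 2] show ?thesis by (simp only: fps_add_nth)
qed

lemma residue_at_minus_a_tendsto:
  "(\<lambda>N. residue (integrand N) (- a)) \<longlonglongrightarrow>
    (\<Sum>(k1, k2, k3) \<in> {(k1, k2, k3). k1 + k2 + k3 = q - 1}.
           ((-1) ^ k1 * Li_Hurwitz (k1 + 1) x (1 - a) - x * Li_Hurwitz (k1 + 1) (inverse x) a)
           * (-1) ^ (k2 + k3)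
           * of_nat ((k2 + p1 - 1) choose (p1 - 1)) * of_nat ((k3 + p2 - 1) choose (p2 - 1))
           * Li_Hurwitz (k2 + p1) x1 (- a) * Li_Hurwitz (k3 + p2) x2 (- a)
           * inverse (x1 * x2))"
  unfolding residue_at_minus_a
proof (rule tendsto_sum, clarify)
  fix k1 k2 k3
  note tendsto_mult[OF tendsto_mult[OF kernel_fps_tendsto[of k1] lerch_partial_fps_tendsto[OF p1 norm_x1 px1, of k2]]
      lerch_partial_fps_tendsto[OF p2 norm_x2 px2, of k3]]
  then show "(\<lambda>N. fps_nth (lerch_partial_fps N x 1 (- a) + (\<Sum>m\<le>N. fps_const (inverse x ^ Suc m) * fps_recip_power (- (of_nat (Suc m) + a)) 1)) k1 *
       fps_nth (lerch_partial_fps N x1 p1 (- a)) k2 * fps_nth (lerch_partial_fps N x2 p2 (- a)) k3) \<longlonglongrightarrow>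
     ((-1) ^ k1 * Li_Hurwitz (k1 + 1) x (1 - a) - x * Li_Hurwitz (k1 + 1) (inverse x) a)
           * (-1) ^ (k2 + k3)
           * of_nat ((k2 + p1 - 1) choose (p1 - 1)) * of_nat ((k3 + p2 - 1) choose (p2 - 1))
           * Li_Hurwitz (k2 + p1) x1 (- a) * Li_Hurwitz (k3 + p2) x2 (- a)
           * inverse (x1 * x2)"
    by (simp only: power_add inverse_mult_distrib mult_ac)
qed

lemma nonpos_residues_approx:
  "(\<lambda>N. (\<Sum>n\<le>N. residue (integrand N) (- of_nat n)) - (\<Sum>n\<le>N. neg_residue n)) \<longlonglongrightarrow> 0"
proof -
  let ?U = "\<lambda>N n. (1 + fps_X * bilateral_fps x 1 (N - n) (N + 1 + n)) *
     (1 + fps_X ^ p1 * bilateral_fps x1 p1 (N - n) n) * (1 + fps_X ^ p2 * bilateral_fps x2 p2 (N - n) n)"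
  let ?V = "\<lambda>n. (1 + fps_X * Abs_fps (D_coeff x)) *
     (1 + fps_X ^ p1 * bilateral_lim_fps x1 p1 n) * (1 + fps_X ^ p2 * bilateral_lim_fps x2 p2 n)"
  have "fps_close ?U ?V"
    by (intro fps_close_mult fps_close_add fps_close_const fps_close_bilateral fps_close_bilateral_kernel
        p1 p2 norm_x norm_x1 norm_x2 x_neq_1 px1 px2)
  \<comment> \<open>The coefficients of the three brackets are merely bounded in n; the weight
    1/(n+1) comes from \<open>H\<close>, as k + q >= 1.\<close>
  moreover have "\<exists>B. \<forall>n. norm (fps_nth (H n) k) \<le> B / real (Suc n)" for k
  proof -
    obtain C where C: "C \<ge> 1" "\<And>n. norm (1 / (of_nat n + - a) ^ (k + q)) \<le> C / real (Suc n) ^ (k + q)"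
      using recip_shift_power_bound[of "- a" "k + q"] add_a_nonzero(2) by blast
    let ?b = "of_nat ((k + q - 1) choose (q - 1)) :: complex"
    have "norm (fps_nth (H n) k) \<le> (norm ?b * C) / real (Suc n)" for n
    proof -
      have "norm (fps_nth (H n) k) = norm ?b * norm (1 / (of_nat n + - a) ^ (k + q))"
        by (simp add: H_nth norm_mult norm_divide norm_power)
      also have "\<dots> \<le> norm ?b * (C / real (Suc n) ^ (k + q))"
        by (intro mult_left_mono C) simp
      also have "\<dots> \<le> norm ?b * (C / real (Suc n) ^ 1)"
        using C(1) q by (intro mult_left_mono divide_left_mono power_increasing) auto
      finally show ?thesis by simp
    qed
    then show ?thesis by blast
  qed
  moreover have "norm (y ^ n) = 1" for n by (simp add: norm_power norm_y)
  ultimately have "(\<lambda>N. (\<Sum>n\<le>N. y ^ n * fps_nth (?U N n * H n) (p1 + p2)) -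
      (\<Sum>n\<le>N. y ^ n * fps_nth (?V n * H n) (p1 + p2))) \<longlonglongrightarrow> 0"
    by (rule fps_close_sum_tendsto)
  moreover have "(\<Sum>n\<le>N. residue (integrand N) (- of_nat n)) = (\<Sum>n\<le>N. y ^ n * fps_nth (?U N n * H n) (p1 + p2))" for N
    by (intro sum.cong refl residue_at_nonpos) simp
  ultimately show ?thesis
    by (simp only: neg_residue_def)
qed

text \<open>A tail cut after N + 1 terms has error O(1/(N + m + 2)), in particular O(1/(N - m + 1)),
  so the estimate for the nonpositive poles applies here as well.\<close>

lemma pos_residues_approx:
  "(\<lambda>N. (\<Sum>m\<le>N. residue (integrand N) (of_nat (Suc m))) - (\<Sum>m\<le>N. pos_residue m)) \<longlonglongrightarrow> 0"
proof -
  have *: "close (\<lambda>N m. zeta_partial (N + 1 + m) p u - zeta_partial m p u) (\<lambda>m. Li p u - zeta_partial m p u)"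
    if pu: "p \<ge> 1" "norm u = 1" "(p, u) \<noteq> (1, 1)" for p u
  proof -
    obtain C where "\<And>n. norm (zeta_partial n p u) \<le> C"
      using bounded_zeta_partial[OF pu] by blast
    then have "close (\<lambda>N m. - zeta_partial m p u) (\<lambda>m. - zeta_partial m p u)"
      by (intro close_refl) simp
    moreover have "close (\<lambda>N m. zeta_partial (N + 1 + m) p u) (\<lambda>m. Li p u)"
      by (rule close_zeta_partial) (use pu in auto)
    ultimately show ?thesis using close_add by fastforce
  qed
  have nz: "of_nat n + (a + 1) \<noteq> 0" for n using add_a_nonzero(1)[of "Suc n"] by (simp add: add_ac)
  obtain C where C: "C \<ge> 1" "\<And>n. norm (1 / (of_nat n + (a + 1)) ^ q) \<le> C / real (Suc n) ^ q"
    using recip_shift_power_bound[of "a + 1" q] nz by blast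
  have "norm (inverse y ^ Suc n / (of_nat (Suc n) + a) ^ q) \<le> C / real (Suc n)" for n
  proof -
    have "norm (inverse y ^ Suc n / (of_nat (Suc n) + a) ^ q) = norm (1 / (of_nat n + (a + 1)) ^ q)"
      unfolding norm_divide norm_power norm_inverses by (simp add: add_ac)
    also have "\<dots> \<le> C / real (Suc n) ^ q" by (rule C)
    also have "\<dots> \<le> C / real (Suc n) ^ 1"
      using C(1) q by (intro divide_left_mono power_increasing) auto
    finally show ?thesis by simp
  qed
  from close_sum_tendsto[OF close_mult[OF *[OF p1 norm_x1 px1] *[OF p2 norm_x2 px2]] this]
  show ?thesis by (simp add: pos_residue_def residue_at_pos del: of_nat_Suc power_Suc)
qed

lemma residue_limit_relation:
  assumes "(\<lambda>N. residue (integrand N) (- a)) \<longlonglongrightarrow> r" "pos_residue sums s" "neg_residue sums t"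
  shows "r + s + t = 0"
proof -
  \<comment> \<open>The limiting partial sums are added and subtracted: the differences tend to 0,
    the partial sums to \<open>s\<close> and \<open>t\<close>, and the total is 0 for every
    N.\<close>
  have "(\<lambda>N. residue (integrand N) (- a)
      + (((\<Sum>m\<le>N. residue (integrand N) (of_nat (Suc m))) - (\<Sum>m\<le>N. pos_residue m)) + (\<Sum>m\<le>N. pos_residue m))
      + (((\<Sum>n\<le>N. residue (integrand N) (- of_nat n)) - (\<Sum>n\<le>N. neg_residue n)) + (\<Sum>n\<le>N. neg_residue n)))
    \<longlonglongrightarrow> r + (0 + s) + (0 + t)"
    using assms unfolding sums_def_le
    by (intro tendsto_add pos_residues_approx nonpos_residues_approx)
  moreover have "residue (integrand N) (- a)
      + (((\<Sum>m\<le>N. residue (integrand N) (of_nat (Suc m))) - (\<Sum>m\<le>N. pos_residue m)) + (\<Sum>m\<le>N. pos_residue m))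
      + (((\<Sum>n\<le>N. residue (integrand N) (- of_nat n)) - (\<Sum>n\<le>N. neg_residue n)) + (\<Sum>n\<le>N. neg_residue n)) = 0" for N
    using sum_residues_integrand[of N] by (simp add: algebra_simps del: of_nat_Suc)
  ultimately have "(\<lambda>N::nat. 0) \<longlonglongrightarrow> r + s + t" by simp
  then show ?thesis by (simp add: LIMSEQ_const_iff)
qed

end

theorem theorem3p11:
  fixes x x1 x2 y a :: complex and p1 p2 q :: nat
  assumes "root_of_unity x" and "root_of_unity x1" and "root_of_unity x2"
    and "x \<noteq> 1"
    and "a \<notin> \<int>"
    and "p1 \<ge> 1" and "p2 \<ge> 1" and "q \<ge> 1"
    and y: "y = x * x1 * x2"
    and "(p1, x1) \<noteq> (1, 1)" and "(p2, x2) \<noteq> (1, 1)" and "(q, y) \<noteq> (1, 1)"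
  shows
    "(-1) ^ (p1 + p2 + q + 1) * Rsum (- a) [(p1, inverse x1), (p2, inverse x2)] q y
       - inverse y * Rsum (a + 1) [(p1, x1), (p2, x2)] q (inverse y)
     = Li p1 x1 * Li p2 x2 * Li_Hurwitz q (inverse y) (a + 1)
       - inverse y * Li p1 x1 * Rsum (a + 1) [(p2, x2)] q (inverse y)
       - inverse y * Li p2 x2 * Rsum (a + 1) [(p1, x1)] q (inverse y)
       + (-1) ^ q * inverse y * of_nat ((q + p1 + p2 - 1) choose (q - 1))
           * Li_Hurwitz (q + p1 + p2) y (- a)
       + (-1) ^ q * (\<Sum>k=0..p1.
           of_nat ((k + p2 - 1) choose (p2 - 1)) * of_nat ((q + p1 - k - 1) choose (q - 1))
           * ((-1) ^ k * inverse y * Li (k + p2) x2 * Li_Hurwitz (p1 + q - k) y (- a)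
              + (-1) ^ p2 * Rsum (- a) [(k + p2, inverse x2)] (p1 + q - k) y))
       + (-1) ^ q * (\<Sum>k=0..p2.
           of_nat ((k + p1 - 1) choose (p1 - 1)) * of_nat ((q + p2 - k - 1) choose (q - 1))
           * ((-1) ^ k * inverse y * Li (k + p1) x1 * Li_Hurwitz (p2 + q - k) y (- a)
              + (-1) ^ p1 * Rsum (- a) [(k + p1, inverse x1)] (p2 + q - k) y))
       + (-1) ^ q * inverse y * (\<Sum>k=0..p1 + p2 - 1.
           of_nat ((q + p1 + p2 - k - 2) choose (q - 1)) * D_coeff x k
           * Li_Hurwitz (q + p1 + p2 - k - 1) y (- a))
       + (-1) ^ q * inverse y * Li p1 x1 * Li p2 x2 * Li_Hurwitz q y (- a)
       + (-1) ^ (q + p2) * Li p1 x1 * Rsum (- a) [(p2, inverse x2)] q y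
       + (-1) ^ (q + p1) * Li p2 x2 * Rsum (- a) [(p1, inverse x1)] q y
       + (-1) ^ q * (\<Sum>(k1, k2) \<in> {(k1, k2). k1 + k2 \<le> p1 - 1}.
           of_nat ((k2 + p2 - 1) choose (p2 - 1))
           * of_nat ((q + p1 - k1 - k2 - 2) choose (q - 1)) * D_coeff x k1
           * ((-1) ^ k2 * inverse y * Li (k2 + p2) x2 * Li_Hurwitz (p1 + q - k1 - k2 - 1) y (- a)
              + (-1) ^ p2 * Rsum (- a) [(k2 + p2, inverse x2)] (p1 + q - k1 - k2 - 1) y))
       + (-1) ^ q * (\<Sum>(k1, k2) \<in> {(k1, k2). k1 + k2 \<le> p2 - 1}.
           of_nat ((k2 + p1 - 1) choose (p1 - 1))
           * of_nat ((q + p2 - k1 - k2 - 2) choose (q - 1)) * D_coeff x k1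
           * ((-1) ^ k2 * inverse y * Li (k2 + p1) x1 * Li_Hurwitz (p2 + q - k1 - k2 - 1) y (- a)
              + (-1) ^ p1 * Rsum (- a) [(k2 + p1, inverse x1)] (p2 + q - k1 - k2 - 1) y))
       + (\<Sum>(k1, k2, k3) \<in> {(k1, k2, k3). k1 + k2 + k3 = q - 1}.
           ((-1) ^ k1 * Li_Hurwitz (k1 + 1) x (1 - a) - x * Li_Hurwitz (k1 + 1) (inverse x) a)
           * (-1) ^ (k2 + k3)
           * of_nat ((k2 + p1 - 1) choose (p1 - 1)) * of_nat ((k3 + p2 - 1) choose (p2 - 1))
           * Li_Hurwitz (k2 + p1) x1 (- a) * Li_Hurwitz (k3 + p2) x2 (- a)
           * inverse (x1 * x2))"
proof -
  interpret twisted_kernel x x1 x2 y a p1 p2 q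
    using assms by unfold_locales (simp_all add: norm_root_of_unity)
  \<comment> \<open>\<open>v\<close> and \<open>s4\<close> are the R-sums with two partial zeta
    sums, from the nonpositive and the positive poles; they are the terms that end up on the left
    side of the theorem. The grouping of the premise copies that of the three limit statements, so
    that resolution matches them.\<close>
  have rearrange: "- v = s1 - s2 - s3 + t1 + t2 + t3 + t4 + t5 + t6 + t7 + t8 + t9 + r + s4"
    if "r + (s1 - s2 - s3 + s4) + (t1 + t2 + t3 + t4 + (t5 + t6 + t7 + v) + t8 + t9) = 0"
    for v r s1 s2 s3 s4 t1 t2 t3 t4 t5 t6 t7 t8 t9 :: complex
    using that by (simp add: algebra_simps add_eq_0_iff)
  have sign: "(-1) ^ (p1 + p2 + q + 1) * z = - ((-1) ^ (p1 + p2 + q) * z)" for z :: complex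
    by simp
  show ?thesis
    unfolding sign diff_eq_eq
    by (rule rearrange, rule residue_limit_relation)
       (rule residue_at_minus_a_tendsto sums_pos_residue sums_neg_residue)+
qed

end
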